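(* Suppose that $Z^{\otimes 2}$ decomposes as a direct sum $\bigoplus_{i=1}^d Y_i$ of $d$ mutually non-isomorphic simple objects, $2\le d\le 5$, each of non-zero dimension, with $Y_1\cong \mathbf 1$, and that the braiding $c$ acts on $Y_i$ via the scalar $\lambda_i$, with $\lambda_i\ne\lambda_j$ for $i\neq j$. Then $$\dim Y_i=\frac{Q^{(d)}_{1i}\,(\dim Z)^2}{P^{(d)}_1(\lambda_1)\,P^{(d)}_i(\lambda_i)} .$$
   Context: Setting: $\mathcal C$ is a semisimple ribbon (in particular braided) tensor category over an algebraically closed field $K$ with trivial object $\mathbf 1$ (Hom spaces are $K$-vector spaces and endomorphism algebras of objects are semisimple $K$-algebras). $Z$ is a simple selfdual object: $\mathbf 1$ appears with multiplicity one as a direct summand of $Z^{\otimes 2}$. Let $p\in \mathrm{End}(Z^{\otimes 2})$ be the projection onto $\mathbf 1$, and $p_1=p\otimes 1$, $p_2=1\otimes p$ in $\mathrm{End}(Z^{\otimes 3})$. It is assumed that $p_2p_1p_2\neq 0$. For $a\in\mathrm{End}(Z^{\otimes 2})$, $p_2(a\otimes 1)p_2$ is a scalar multiple of $p_2$. For a direct summand $Y$ of $Z^{\otimes 2}$ with projection $p_Y$ (relative to the chosen decomposition), the dimension $\dim Y\in K$ is defined by $(\dim Y)\,p_2=(\dim Z)^2\,p_2(p_Y\otimes 1)p_2$, where $\dim Z$ is fixed (up to a sign that does not affect $\dim Y$) by requiring $\dim\mathbf 1=1$. Let $c\in\mathrm{End}(Z^{\otimes 2})$ be the braiding, $c_1=c\otimes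 1$, $c_2=1\otimes c$; then $c_1c_2c_1=c_2c_1c_2$. The braid group $B_3=\langle\sigma_1,\sigma_2\mid\sigma_1\sigma_2\sigma_1=\sigma_2\sigma_1\sigma_2\rangle$ acts on $\mathrm{Hom}(Z,Z^{\otimes 3})$ by $\sigma_jf=c_j\circ f$; under the hypotheses of the claim this is a simple $d$-dimensional module. Let $A$, $B$ be the endomorphisms by which $\sigma_1,\sigma_2$ act on it; $A$ has eigenvalues $\lambda_1,\dots,\lambda_d$. $P^{(d)}_r(x)=\prod_{i\neq r}(x-\lambda_i)$, and $Q^{(d)}_{rs}$ is the scalar defined by $P_r^{(d)}(A)P_s^{(d)}(B)P_r^{(d)}(A)=Q_{rs}^{(d)}P_r^{(d)}(A)$. For $r\ne s$ it is given explicitly by: $Q_{rs}^{(2)}=-\lambda_r^2+\lambda_r\lambda_s-\lambda_s^2$; $Q_{rs}^{(3)}=(\lambda_r^2+\lambda_s\lambda_k)(\lambda_s^2+\lambda_r\lambda_k)$ with $\{r,s,k\}=\{1,2,3\}$; $Q_{rs}^{(4)}=-\gamma^{-2}(\lambda_r^2+\gamma^2)(\lambda_s^2+\gamma^2)(\gamma^2+\lambda_r\lambda_k+\lambda_s\lambda_l)(\gamma^2+\lambda_r\lambda_l+\lambda_s\lambda_k)$ with $\{r,s,k,l\}=\{1,2,3,4\}$; $Q_{rs}^{(5)}=\gamma^{-8}(\gamma^2+\lambda_r\gamma+\lambda_r^2)(\gamma^2+\lambda_s\gamma+\lambda_s^2)\prod_{k\neq r,s}(\gamma^2+\lambda_r\lambda_k)(\gamma^2+\lambda_s\lambda_k)$.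 Here, with $\delta$ the scalar by which $(\sigma_1\sigma_2)^3$ acts on the module, $\gamma^2=-\delta/\det(A)$ for $d=4$ and $\gamma=\delta/\det(A)$ for $d=5$. *)

theory Defs
  imports Complex_Main "HOL-Computational_Algebra.Polynomial"
begin

section \<open>Linear categories\<close>

text \<open>
  The objects are the elements of a type \<open>'o\<close>. All morphisms live in one ambient \<open>'k\<close>-vector
  space \<open>'m\<close> (the direct sum of all Hom spaces is always a possible choice), and \<open>Hom C X Y\<close> is a
  subspace of it. Composition (and later the tensor product of morphisms) is a total operation on
  \<open>'m\<close> of which only the values on the Hom spaces matter. The zero morphisms are
  identified, and the Hom spaces are not required to be otherwise disjoint, so predicates on
  morphisms carry source and target along.
\<close>

record ('k, 'o, 'm) linear_cat =
  scl :: "'k \<Rightarrow> 'm \<Rightarrow> 'm" (infixr \<open>\<odot>\<index>\<close> 75)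
  Hom :: "'o \<Rightarrow> 'o \<Rightarrow> 'm set"
  ident :: "'o \<Rightarrow> 'm"
  compose :: "'m \<Rightarrow> 'm \<Rightarrow> 'm" (infixr \<open>\<cdot>\<index>\<close> 70)

locale linear_category = vector_space "scl C"
  for C :: "('k::field, 'o, 'm::ab_group_add, 'x) linear_cat_scheme" (structure) +
  assumes Hom_subspace: "subspace (Hom C X Y)"
    and ident_in_Hom: "ident C X \<in> Hom C X X"
    and compose_in_Hom: "g \<in> Hom C Y W \<Longrightarrow> f \<in> Hom C X Y \<Longrightarrow> g \<cdot> f \<in> Hom C X W"
    and compose_assoc: "h \<in> Hom C W V \<Longrightarrow> g \<in> Hom C Y W \<Longrightarrow> f \<in> Hom C X Y \<Longrightarrow>
      (h \<cdot> g) \<cdot> f = h \<cdot> (g \<cdot> f)"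
    and ident_left: "f \<in> Hom C X Y \<Longrightarrow> ident C Y \<cdot> f = f"
    and ident_right: "f \<in> Hom C X Y \<Longrightarrow> f \<cdot> ident C X = f"
    and compose_add_left: "g \<in> Hom C Y W \<Longrightarrow> g' \<in> Hom C Y W \<Longrightarrow> f \<in> Hom C X Y \<Longrightarrow>
      (g + g') \<cdot> f = g \<cdot> f + g' \<cdot> f"
    and compose_add_right: "g \<in> Hom C Y W \<Longrightarrow> f \<in> Hom C X Y \<Longrightarrow> f' \<in> Hom C X Y \<Longrightarrow>
      g \<cdot> (f + f') = g \<cdot> f + g \<cdot> f'"
    and compose_scl_left: "g \<in> Hom C Y W \<Longrightarrow> f \<in> Hom C X Y \<Longrightarrow> (a \<odot> g) \<cdot> f = a \<odot> (g \<cdot> f)"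
    and compose_scl_right: "g \<in> Hom C Y W \<Longrightarrow> f \<in> Hom C X Y \<Longrightarrow> g \<cdot> (a \<odot> f) = a \<odot> (g \<cdot> f)"

context
  fixes C :: "('k::field, 'o, 'm::ab_group_add, 'x) linear_cat_scheme" (structure)
begin

definition is_iso :: "'o \<Rightarrow> 'o \<Rightarrow> 'm \<Rightarrow> bool" where
  "is_iso X Y f \<longleftrightarrow> f \<in> Hom C X Y \<and>
     (\<exists>g \<in> Hom C Y X. g \<cdot> f = ident C X \<and> f \<cdot> g = ident C Y)"

definition inverse_mor :: "'o \<Rightarrow> 'o \<Rightarrow> 'm \<Rightarrow> 'm" where
  "inverse_mor X Y f = (THE g. g \<in> Hom C Y X \<and> g \<cdot> f = ident C X \<and> f \<cdot> g = ident C Y)"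

definition isomorphic :: "'o \<Rightarrow> 'o \<Rightarrow> bool" where
  "isomorphic X Y \<longleftrightarrow> (\<exists>f. is_iso X Y f)"

definition is_mono :: "'o \<Rightarrow> 'o \<Rightarrow> 'm \<Rightarrow> bool" where
  "is_mono X Y f \<longleftrightarrow> f \<in> Hom C X Y \<and>
     (\<forall>W. \<forall>g \<in> Hom C W X. \<forall>h \<in> Hom C W X. f \<cdot> g = f \<cdot> h \<longrightarrow> g = h)"

text \<open>Nonzero, with no subobjects other than the zero object and the object itself.\<close>

definition simple_object :: "'o \<Rightarrow> bool" where
  "simple_object X \<longleftrightarrow> ident C X \<noteq> 0 \<and> (\<forall>W f. is_mono W X f \<longrightarrow> f = 0 \<or> is_iso W X f)"

definition direct_summand :: "'o \<Rightarrow> 'o \<Rightarrow> bool" where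
  "direct_summand Y X \<longleftrightarrow> (\<exists>i \<in> Hom C Y X. \<exists>r \<in> Hom C X Y. r \<cdot> i = ident C Y)"

definition direct_sum :: "'o \<Rightarrow> 'i set \<Rightarrow> ('i \<Rightarrow> 'o) \<Rightarrow> ('i \<Rightarrow> 'm) \<Rightarrow> ('i \<Rightarrow> 'm) \<Rightarrow> bool" where
  "direct_sum X I Y inc prj \<longleftrightarrow> finite I \<and>
     (\<forall>i \<in> I. inc i \<in> Hom C (Y i) X \<and> prj i \<in> Hom C X (Y i)) \<and>
     (\<forall>i \<in> I. \<forall>j \<in> I. prj i \<cdot> inc j = (if i = j then ident C (Y i) else 0)) \<and>
     (\<Sum>i \<in> I. inc i \<cdot> prj i) = ident C X"

definition projection_onto :: "'o \<Rightarrow> 'o \<Rightarrow> 'm \<Rightarrow> bool" where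
  "projection_onto X Y p \<longleftrightarrow>
     (\<exists>i \<in> Hom C Y X. \<exists>r \<in> Hom C X Y. r \<cdot> i = ident C Y \<and> p = i \<cdot> r)"

definition left_ideal_End :: "'o \<Rightarrow> 'm set \<Rightarrow> bool" where
  "left_ideal_End X L \<longleftrightarrow> module.subspace (scl C) L \<and> L \<subseteq> Hom C X X \<and>
     (\<forall>a \<in> Hom C X X. \<forall>l \<in> L. a \<cdot> l \<in> L)"

text \<open>The algebra \<open>End(X)\<close> is semisimple: every left ideal has a complementary left ideal.\<close>

definition semisimple_End :: "'o \<Rightarrow> bool" where
  "semisimple_End X \<longleftrightarrow>
     (\<forall>L. left_ideal_End X L \<longrightarrow>
        (\<exists>L'. left_ideal_End X L' \<and> L \<inter> L' = {0} \<and>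
              (\<forall>f \<in> Hom C X X. \<exists>l \<in> L. \<exists>l' \<in> L'. f = l + l')))"

end

section \<open>Semisimple ribbon categories\<close>

text \<open>
  \<open>assoc X Y W\<close> goes from \<open>(X \<otimes> Y) \<otimes> W\<close> to \<open>X \<otimes> (Y \<otimes> W)\<close>; the
  category is not assumed to be strict.
\<close>

record ('k, 'o, 'm) ribbon_cat = "('k, 'o, 'm) linear_cat" +
  tens :: "'o \<Rightarrow> 'o \<Rightarrow> 'o" (infixr \<open>\<otimes>\<index>\<close> 80)
  tens_mor :: "'m \<Rightarrow> 'm \<Rightarrow> 'm" (infixr \<open>\<boxtimes>\<index>\<close> 80)
  unit_obj :: "'o" (\<open>\<one>\<index>\<close>)
  assoc :: "'o \<Rightarrow> 'o \<Rightarrow> 'o \<Rightarrow> 'm"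
  lunit :: "'o \<Rightarrow> 'm"
  runit :: "'o \<Rightarrow> 'm"
  braiding :: "'o \<Rightarrow> 'o \<Rightarrow> 'm"
  dual :: "'o \<Rightarrow> 'o"
  evl :: "'o \<Rightarrow> 'm"
  coevl :: "'o \<Rightarrow> 'm"
  twist :: "'o \<Rightarrow> 'm"

abbreviation assoc_inv :: "('k::field, 'o, 'm::ab_group_add, 'x) ribbon_cat_scheme \<Rightarrow> 'o \<Rightarrow> 'o \<Rightarrow> 'o \<Rightarrow> 'm" where
  "assoc_inv C X Y W \<equiv>
     inverse_mor C (tens C (tens C X Y) W) (tens C X (tens C Y W)) (assoc C X Y W)"

locale linear_monoidal_category = linear_category C
  for C :: "('k::field, 'o, 'm::ab_group_add, 'x) ribbon_cat_scheme" (structure) +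
  assumes tens_in_Hom: "f \<in> Hom C X X' \<Longrightarrow> g \<in> Hom C Y Y' \<Longrightarrow> f \<boxtimes> g \<in> Hom C (X \<otimes> Y) (X' \<otimes> Y')"
    and tens_ident: "ident C X \<boxtimes> ident C Y = ident C (X \<otimes> Y)"
    and interchange: "f \<in> Hom C X X' \<Longrightarrow> f' \<in> Hom C X' X'' \<Longrightarrow> g \<in> Hom C Y Y' \<Longrightarrow> g' \<in> Hom C Y' Y'' \<Longrightarrow>
      (f' \<cdot> f) \<boxtimes> (g' \<cdot> g) = (f' \<boxtimes> g') \<cdot> (f \<boxtimes> g)"
    and tens_add_left: "f \<in> Hom C X X' \<Longrightarrow> f' \<in> Hom C X X' \<Longrightarrow> g \<in> Hom C Y Y' \<Longrightarrow>
      (f + f') \<boxtimes> g = (f \<boxtimes> g) + (f' \<boxtimes> g)"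
    and tens_add_right: "f \<in> Hom C X X' \<Longrightarrow> g \<in> Hom C Y Y' \<Longrightarrow> g' \<in> Hom C Y Y' \<Longrightarrow>
      f \<boxtimes> (g + g') = (f \<boxtimes> g) + (f \<boxtimes> g')"
    and tens_scl_left: "f \<in> Hom C X X' \<Longrightarrow> g \<in> Hom C Y Y' \<Longrightarrow> (a \<odot> f) \<boxtimes> g = a \<odot> (f \<boxtimes> g)"
    and tens_scl_right: "f \<in> Hom C X X' \<Longrightarrow> g \<in> Hom C Y Y' \<Longrightarrow> f \<boxtimes> (a \<odot> g) = a \<odot> (f \<boxtimes> g)"
    and assoc_iso: "is_iso C ((X \<otimes> Y) \<otimes> W) (X \<otimes> (Y \<otimes> W)) (assoc C X Y W)"
    and assoc_natural: "f \<in> Hom C X X' \<Longrightarrow> g \<in> Hom C Y Y' \<Longrightarrow> h \<in> Hom C W W' \<Longrightarrow>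
      assoc C X' Y' W' \<cdot> ((f \<boxtimes> g) \<boxtimes> h) = (f \<boxtimes> (g \<boxtimes> h)) \<cdot> assoc C X Y W"
    and lunit_iso: "is_iso C (\<one> \<otimes> X) X (lunit C X)"
    and lunit_natural: "f \<in> Hom C X Y \<Longrightarrow> lunit C Y \<cdot> (ident C \<one> \<boxtimes> f) = f \<cdot> lunit C X"
    and runit_iso: "is_iso C (X \<otimes> \<one>) X (runit C X)"
    and runit_natural: "f \<in> Hom C X Y \<Longrightarrow> runit C Y \<cdot> (f \<boxtimes> ident C \<one>) = f \<cdot> runit C X"
    and pentagon:
      "(ident C X \<boxtimes> assoc C Y W V) \<cdot> assoc C X (Y \<otimes> W) V \<cdot> (assoc C X Y W \<boxtimes> ident C V) =
       assoc C X Y (W \<otimes> V) \<cdot> assoc C (X \<otimes> Y) W V"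
    and triangle:
      "(ident C X \<boxtimes> lunit C Y) \<cdot> assoc C X \<one> Y = runit C X \<boxtimes> ident C Y"

locale linear_braided_category = linear_monoidal_category C
  for C :: "('k::field, 'o, 'm::ab_group_add, 'x) ribbon_cat_scheme" (structure) +
  assumes braiding_iso: "is_iso C (X \<otimes> Y) (Y \<otimes> X) (braiding C X Y)"
    and braiding_natural: "f \<in> Hom C X X' \<Longrightarrow> g \<in> Hom C Y Y' \<Longrightarrow>
      braiding C X' Y' \<cdot> (f \<boxtimes> g) = (g \<boxtimes> f) \<cdot> braiding C X Y"
    and hexagon1:
      "assoc C Y W X \<cdot> braiding C X (Y \<otimes> W) \<cdot> assoc C X Y W =
       (ident C Y \<boxtimes> braiding C X W) \<cdot> assoc C Y X W \<cdot> (braiding C X Y \<boxtimes> ident C W)"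
    and hexagon2:
      "assoc_inv C W X Y \<cdot> braiding C (X \<otimes> Y) W \<cdot> assoc_inv C X Y W =
       (braiding C X W \<boxtimes> ident C Y) \<cdot> assoc_inv C X W Y \<cdot> (ident C X \<boxtimes> braiding C Y W)"

locale linear_ribbon_category = linear_braided_category C
  for C :: "('k::field, 'o, 'm::ab_group_add, 'x) ribbon_cat_scheme" (structure) +
  assumes evl_in_Hom: "evl C X \<in> Hom C (dual C X \<otimes> X) \<one>"
    and coevl_in_Hom: "coevl C X \<in> Hom C \<one> (X \<otimes> dual C X)"
    and zigzag1:
      "runit C X \<cdot> (ident C X \<boxtimes> evl C X) \<cdot> assoc C X (dual C X) X \<cdot> (coevl C X \<boxtimes> ident C X) =
       lunit C X"
    and zigzag2:
      "lunit C (dual C X) \<cdot> (evl C X \<boxtimes> ident C (dual C X)) \<cdot> assoc_inv C (dual C X) X (dual C X) \<cdot>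
         (ident C (dual C X) \<boxtimes> coevl C X) =
       runit C (dual C X)"
    and twist_iso: "is_iso C X X (twist C X)"
    and twist_natural: "f \<in> Hom C X Y \<Longrightarrow> twist C Y \<cdot> f = f \<cdot> twist C X"
    and twist_tens:
      "twist C (X \<otimes> Y) = braiding C Y X \<cdot> braiding C X Y \<cdot> (twist C X \<boxtimes> twist C Y)"
    and twist_dual:
      "(twist C X \<boxtimes> ident C (dual C X)) \<cdot> coevl C X =
       (ident C X \<boxtimes> twist C (dual C X)) \<cdot> coevl C X"

text \<open>
  Finite direct sums exist (the empty one being a zero object), idempotents split, Hom spaces
  are finite-dimensional and endomorphism algebras are semisimple.
\<close>

locale semisimple_ribbon_category = linear_ribbon_category C
  for C :: "('k::alg_closed_field, 'o, 'm::ab_group_add, 'x) ribbon_cat_scheme" (structure) +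
  assumes direct_sums_exist:
      "\<exists>X inc prj. direct_sum C X {..<n::nat} Ys inc prj"
    and idempotents_split:
      "e \<in> Hom C X X \<Longrightarrow> e \<cdot> e = e \<Longrightarrow> \<exists>Y. projection_onto C X Y e"
    and Hom_finite_dim: "\<exists>B. finite B \<and> Hom C X Y = span B"
    and End_semisimple: "semisimple_End C X"

section \<open>Self-dual objects, dimensions, and the braid group action\<close>

context
  fixes C :: "('k::field, 'o, 'm::ab_group_add, 'x) ribbon_cat_scheme" (structure)
begin

text \<open>The unit object is a direct summand of \<open>Z \<otimes> Z\<close> of multiplicity one.\<close>

definition selfdual_object :: "'o \<Rightarrow> bool" where
  "selfdual_object Z \<longleftrightarrow>
     (\<exists>Y inc prj. direct_sum C (Z \<otimes> Z) {0, 1::nat} Y inc prj \<and> Y 0 = \<one> \<and>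
        \<not> direct_summand C \<one> (Y 1))"

text \<open>
  The endomorphisms \<open>a \<otimes> 1\<close> and \<open>1 \<otimes> a\<close> of \<open>Z\<^sup>3 = (Z \<otimes> Z) \<otimes> Z\<close> for an
  endomorphism \<open>a\<close> of \<open>Z \<otimes> Z\<close>.
\<close>

definition cube :: "'o \<Rightarrow> 'o" where
  "cube Z = (Z \<otimes> Z) \<otimes> Z"

definition on12 :: "'o \<Rightarrow> 'm \<Rightarrow> 'm" where
  "on12 Z a = a \<boxtimes> ident C Z"

definition on23 :: "'o \<Rightarrow> 'm \<Rightarrow> 'm" where
  "on23 Z a = assoc_inv C Z Z Z \<cdot> (ident C Z \<boxtimes> a) \<cdot> assoc C Z Z Z"

text \<open>
  The dimension of the direct summand of \<open>Z \<otimes> Z\<close> with projection \<open>q\<close>, where \<open>p\<close> is the projection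
  onto the unit object and \<open>z\<close> is the dimension of \<open>Z\<close>. The scalar \<open>z\<close> is itself determined up to
  sign by requiring \<open>summand_dim Z p z p = 1\<close>.
\<close>

definition summand_dim :: "'o \<Rightarrow> 'm \<Rightarrow> 'k \<Rightarrow> 'm \<Rightarrow> 'k" where
  "summand_dim Z p z q =
     (THE y. y \<odot> on23 Z p = z\<^sup>2 \<odot> (on23 Z p \<cdot> on12 Z q \<cdot> on23 Z p))"

definition sigma1 :: "'o \<Rightarrow> 'm \<Rightarrow> 'm" where
  "sigma1 Z f = on12 Z (braiding C Z Z) \<cdot> f"

definition sigma2 :: "'o \<Rightarrow> 'm \<Rightarrow> 'm" where
  "sigma2 Z f = on23 Z (braiding C Z Z) \<cdot> f"

end

definition poly_endo :: "('k::field \<Rightarrow> 'm::ab_group_add \<Rightarrow> 'm) \<Rightarrow> 'k poly \<Rightarrow> ('m \<Rightarrow> 'm) \<Rightarrow> 'm \<Rightarrow> 'm" where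
  "poly_endo scale F T v = (\<Sum>i\<le>degree F. scale (coeff F i) ((T ^^ i) v))"

definition P_poly :: "nat \<Rightarrow> (nat \<Rightarrow> 'k::field) \<Rightarrow> nat \<Rightarrow> 'k poly" where
  "P_poly d lam r = (\<Prod>i\<in>{1..d} - {r}. [:- lam i, 1:])"

text \<open>
  The scalar \<open>Q\<close> with \<open>P\<^sub>r(A) P\<^sub>s(B) P\<^sub>r(A) = Q P\<^sub>r(A)\<close> on the space \<open>V\<close>.
\<close>

definition Q_scalar :: "('k::field \<Rightarrow> 'm::ab_group_add \<Rightarrow> 'm) \<Rightarrow> 'm set \<Rightarrow> ('m \<Rightarrow> 'm) \<Rightarrow> ('m \<Rightarrow> 'm) \<Rightarrow>
    nat \<Rightarrow> (nat \<Rightarrow> 'k) \<Rightarrow> nat \<Rightarrow> nat \<Rightarrow> 'k" where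
  "Q_scalar scale V A B d lam r s =
     (THE q. \<forall>v \<in> V.
        poly_endo scale (P_poly d lam r) A
          (poly_endo scale (P_poly d lam s) B (poly_endo scale (P_poly d lam r) A v)) =
        scale q (poly_endo scale (P_poly d lam r) A v))"

end

theory Submission
  imports Defs
begin

text \<open>
  Write \<open>q\<^sub>j\<close> for the projection of \<open>Z \<otimes> Z\<close> onto \<open>Y\<^sub>j\<close>, and \<open>a\<^sub>1 = a \<otimes> 1\<close>, \<open>a\<^sub>2 = 1 \<otimes> a\<close> for the
  two ways in which an endomorphism \<open>a\<close> of \<open>Z \<otimes> Z\<close> acts on \<open>Z\<^sup>3\<close>. The braiding is
  \<open>c = \<Sum> \<lambda>\<^sub>j q\<^sub>j\<close> with distinct \<open>\<lambda>\<^sub>j\<close>, so \<open>P\<^sub>r(c) = P\<^sub>r(\<lambda>\<^sub>r) q\<^sub>r\<close>: on \<open>Hom(Z, Z\<^sup>3)\<close> the operators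
  \<open>P\<^sub>r(A)\<close> and \<open>P\<^sub>r(B)\<close> are composition with multiples of \<open>q\<^sub>r \<otimes> 1\<close> and \<open>1 \<otimes> q\<^sub>r\<close>
  (\<open>P_poly_endo_of_eigendecomposition\<close>). The relation that defines \<open>Q\<close> thereby compares the
  sandwich \<open>p\<^sub>1 (q\<^sub>i)\<^sub>2 p\<^sub>1\<close> with \<open>p\<^sub>1\<close>, whereas \<open>dim Y\<^sub>i\<close> compares \<open>p\<^sub>2 (q\<^sub>i)\<^sub>1 p\<^sub>2\<close> with \<open>p\<^sub>2\<close>.

  Three facts connect the two. The given projection \<open>p\<close> onto the unit object equals \<open>q\<^sub>1\<close>, because
  the unit object occurs once among the pairwise non-isomorphic \<open>Y\<^sub>j\<close>
  (\<open>projection_onto_simple_summand\<close>). The morphism \<open>p\<^sub>2\<close> factors through \<open>Z \<otimes> \<one> \<cong> Z\<close>, whose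
  endomorphisms are scalars, so \<open>p\<^sub>2 (q\<^sub>i)\<^sub>1 p\<^sub>2 = t p\<^sub>2\<close> for some \<open>t\<close> (\<open>sandwich_scalar\<close>) and
  \<open>dim Y\<^sub>i = (dim Z)\<^sup>2 t\<close>. Finally the half twist \<open>c\<^sub>1 c\<^sub>2 c\<^sub>1\<close> is invertible and conjugation by it
  exchanges \<open>a\<^sub>1\<close> and \<open>a\<^sub>2\<close> whenever \<open>a\<close> commutes with \<open>c\<close>, so the same \<open>t\<close> satisfies
  \<open>p\<^sub>1 (q\<^sub>i)\<^sub>2 p\<^sub>1 = t p\<^sub>1\<close> (\<open>sandwich_exchange\<close>). Hence \<open>Q\<^sub>1\<^sub>i = t P\<^sub>1(\<lambda>\<^sub>1) P\<^sub>i(\<lambda>\<^sub>i)\<close>.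

  The scalars come from Schur's lemma. Since simplicity is defined by subobjects, and kernels are
  not part of the structure, it is derived from semisimplicity of endomorphism algebras:
  every morphism \<open>f\<close> has the form \<open>f g f\<close> (\<open>von_neumann_regular\<close>), and \<open>f g\<close>, \<open>g f\<close> are then
  idempotents, which between simple objects are \<open>0\<close> or \<open>1\<close>.
\<close>

section \<open>Eigenvectors over an algebraically closed field\<close>

lemma (in vector_space) poly_endo_eq_sum:
  assumes "degree F \<le> n"
  shows "poly_endo scale F T v = (\<Sum>i\<le>n. scale (coeff F i) ((T ^^ i) v))"
  unfolding poly_endo_def using assms
  by (intro sum.mono_neutral_left) (auto simp: coeff_eq_0)

text \<open>
  Linearity is required on an invariant subspace only, as composition of morphisms is a total
  operation that is linear just on the Hom spaces.
\<close>

lemma (in vector_space) poly_endo_linear_factor: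
  assumes V: "subspace V" "v \<in> V"
    and T: "\<And>x. x \<in> V \<Longrightarrow> T x \<in> V"
    and lin: "\<And>x y. x \<in> V \<Longrightarrow> y \<in> V \<Longrightarrow> T (x - y) = T x - T y"
      "\<And>a x. x \<in> V \<Longrightarrow> T (scale a x) = scale a (T x)"
  shows "poly_endo scale ([:- a, 1:] * F) T v = poly_endo scale F T (T v - scale a v)"
proof -
  have pow: "(T ^^ i) x \<in> V" if "x \<in> V" for i x
    using that by (induction i) (auto simp: T)
  have Tv: "(T ^^ i) (T v - scale a v) = (T ^^ Suc i) v - scale a ((T ^^ i) v)" for i
  proof (induction i)
    case (Suc i)
    have "(T ^^ Suc i) (T v - scale a v) = T ((T ^^ Suc i) v - scale a ((T ^^ i) v))"
      using Suc by simp
    also have "\<dots> = T ((T ^^ Suc i) v) - scale a (T ((T ^^ i) v))"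
      using pow[OF V(2)] V(1) by (metis lin subspace_scale)
    finally show ?case by simp
  qed simp
  let ?n = "Suc (degree F)"
  let ?w = "\<lambda>i. (T ^^ i) v"
  have F: "[:- a, 1:] * F = pCons 0 F - smult a F" by simp
  have deg: "degree (pCons 0 F - smult a F) \<le> ?n"
    by (intro degree_diff_le) (auto simp: degree_pCons_le intro: le_SucI)
  have "poly_endo scale ([:- a, 1:] * F) T v =
      (\<Sum>i\<le>?n. scale (coeff (pCons 0 F) i) (?w i)) - (\<Sum>i\<le>?n. scale (a * coeff F i) (?w i))"
    unfolding F poly_endo_eq_sum[OF deg]
    by (simp only: coeff_diff coeff_smult scale_left_diff_distrib sum_subtractf)
  also have "(\<Sum>i\<le>?n. scale (coeff (pCons 0 F) i) (?w i)) =
      (\<Sum>i\<le>degree F. scale (coeff F i) (?w (Suc i)))"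
    by (subst sum.atMost_Suc_shift) simp
  also have "(\<Sum>i\<le>?n. scale (a * coeff F i) (?w i)) =
      (\<Sum>i\<le>degree F. scale (coeff F i) (scale a (?w i)))"
    by (simp add: coeff_eq_0 mult.commute)
  finally show ?thesis
    by (simp only: poly_endo_def Tv scale_right_diff_distrib sum_subtractf)
qed

text \<open>
  Induction on the degree of \<open>F\<close>: for a root \<open>a\<close> of \<open>F\<close>, either \<open>v\<close> is an eigenvector
  for \<open>a\<close>, or \<open>T v - a v\<close> is a nonzero vector annihilated by \<open>F / (x - a)\<close>.
\<close>

lemma (in vector_space) eigenvector_if_annihilated:
  assumes alg_closed: "\<And>F :: 'a poly. degree F > 0 \<Longrightarrow> \<exists>x. poly F x = 0"
    and V: "subspace V"
    and T: "\<And>x. x \<in> V \<Longrightarrow> T x \<in> V"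
    and lin: "\<And>x y. x \<in> V \<Longrightarrow> y \<in> V \<Longrightarrow> T (x - y) = T x - T y"
      "\<And>a x. x \<in> V \<Longrightarrow> T (scale a x) = scale a (T x)"
    and "v \<in> V" "v \<noteq> 0" "F \<noteq> 0" "poly_endo scale F T v = 0"
  shows "\<exists>a. \<exists>w \<in> V. w \<noteq> 0 \<and> T w = scale a w"
  using assms(6-)
proof (induction "degree F" arbitrary: F v)
  case 0
  then obtain b where "F = [:b:]" by (metis degree_eq_zeroE)
  with 0 show ?case by (auto simp: poly_endo_def)
next
  case (Suc n)
  then obtain a where "poly F a = 0" using alg_closed[of F] by auto
  then obtain G where G: "F = [:- a, 1:] * G" by (auto simp: poly_eq_0_iff_dvd elim: dvdE)
  with Suc have G0: "G \<noteq> 0" by auto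
  have degF: "degree F = Suc (degree G)"
    unfolding G using G0 by (subst degree_mult_eq) auto
  let ?w = "T v - scale a v"
  have "?w \<in> V" using V T Suc.prems(1) by (simp add: subspace_diff subspace_scale)
  moreover have "poly_endo scale G T ?w = 0"
    using Suc.prems(4) poly_endo_linear_factor[OF V Suc.prems(1) T lin] by (simp add: G)
  ultimately show ?case
  proof (cases "?w = 0")
    case True
    then show ?thesis using Suc.prems by auto
  next
    case False
    then show ?thesis
      using Suc.hyps(1)[of G ?w] Suc.hyps(2) degF \<open>?w \<in> V\<close> G0
        \<open>poly_endo scale G T ?w = 0\<close> by simp
  qed
qed

text \<open>
  The orbit of \<open>v\<close> lies in a finite-dimensional space. A linear dependence between distinct orbit
  vectors gives the polynomial; if two members of the orbit coincide, the orbit may be independent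
  as a set, and the difference of two monomials is used instead.
\<close>

lemma (in vector_space) annihilating_polynomial_exists:
  assumes "finite B" and pow: "\<And>i. (T ^^ i) v \<in> span B"
  shows "\<exists>F. F \<noteq> 0 \<and> poly_endo scale F T v = 0"
proof (cases "inj (\<lambda>i. (T ^^ i) v)")
  case False
  then obtain i j where ij: "i < j" "(T ^^ i) v = (T ^^ j) v"
    by (metis (mono_tags, lifting) injI linorder_neqE_nat)
  let ?F = "monom 1 j - monom 1 i :: 'a poly"
  have deg: "degree ?F \<le> j"
    using ij by (intro degree_diff_le) (auto intro: order_trans[OF degree_monom_le])
  have nz: "?F \<noteq> 0"
  proof
    assume "?F = 0"
    then have "coeff ?F j = 0" by simp
    with ij show False by simp
  qed
  have "poly_endo scale ?F T v =
      (\<Sum>k\<le>j. scale (if k = j then 1 else 0) ((T ^^ k) v)) -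
      (\<Sum>k\<le>j. scale (if k = i then 1 else 0) ((T ^^ k) v))"
    unfolding poly_endo_eq_sum[OF deg]
    by (simp add: scale_left_diff_distrib sum_subtractf eq_commute)
  also have "\<dots> = (T ^^ j) v - (T ^^ i) v"
    using ij by (simp add: if_distrib[of "\<lambda>c. scale c _"] if_distribR sum.delta cong: if_cong)
  finally have "poly_endo scale ?F T v = 0" using ij by simp
  with nz show ?thesis by blast
next
  case True
  let ?S = "range (\<lambda>i. (T ^^ i) v)"
  have "infinite ?S" using True by (simp add: finite_image_iff)
  moreover have "?S \<subseteq> span B" using pow by auto
  ultimately have "dependent ?S"
    using independent_span_bound[OF assms(1)] by blast
  then obtain S u where S: "finite S" "S \<subseteq> ?S" "(\<Sum>x\<in>S. scale (u x) x) = 0"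
    and nz: "\<exists>x\<in>S. u x \<noteq> 0"
    unfolding dependent_explicit by blast
  obtain I where I: "S = (\<lambda>i. (T ^^ i) v) ` I" using S(2) by (auto simp: subset_image_iff)
  have inj: "inj_on (\<lambda>i. (T ^^ i) v) I" using True by (auto intro: inj_on_subset)
  have finI: "finite I" using S(1) inj unfolding I by (simp add: finite_image_iff)
  define F where "F = (\<Sum>i\<in>I. monom (u ((T ^^ i) v)) i)"
  have coeff: "coeff F i = (if i \<in> I then u ((T ^^ i) v) else 0)" for i
    unfolding F_def using finI by (simp add: coeff_sum)
  obtain n where n: "I \<subseteq> {..n}" using finI by (auto simp: finite_nat_set_iff_bounded_le)
  have deg: "degree F \<le> n" using n by (intro degree_le) (auto simp: coeff)
  have "poly_endo scale F T v = (\<Sum>i\<in>I. scale (u ((T ^^ i) v)) ((T ^^ i) v))"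
    unfolding poly_endo_eq_sum[OF deg] using n
    by (intro sum.mono_neutral_cong_right) (auto simp: coeff)
  also have "\<dots> = 0" using S(3) inj unfolding I by (simp add: sum.reindex)
  finally have "poly_endo scale F T v = 0" .
  moreover have "F \<noteq> 0" using nz I coeff by (metis (no_types, lifting) coeff_0 imageE)
  ultimately show ?thesis by blast
qed

section \<open>Morphisms of a linear category\<close>

context linear_category
begin

lemmas Hom_zero = subspace_0[OF Hom_subspace]
lemmas Hom_add = subspace_add[OF Hom_subspace]
lemmas Hom_diff = subspace_diff[OF Hom_subspace]
lemmas Hom_scl = subspace_scale[OF Hom_subspace]
lemmas Hom_sum = subspace_sum[OF Hom_subspace]

lemma compose_zero_left: "f \<in> Hom C X Y \<Longrightarrow> 0 \<cdot> f = 0"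
  using compose_add_left[OF Hom_zero Hom_zero] by force

lemma compose_zero_right: "g \<in> Hom C Y W \<Longrightarrow> g \<cdot> 0 = 0"
  using compose_add_right[OF _ Hom_zero Hom_zero] by force

lemma compose_diff_left:
  assumes "g \<in> Hom C Y W" "g' \<in> Hom C Y W" "f \<in> Hom C X Y"
  shows "(g - g') \<cdot> f = g \<cdot> f - g' \<cdot> f"
  using compose_add_left[OF Hom_diff[OF assms(1,2)] assms(2,3)] by (simp add: algebra_simps)

lemma compose_diff_right:
  assumes "g \<in> Hom C Y W" "f \<in> Hom C X Y" "f' \<in> Hom C X Y"
  shows "g \<cdot> (f - f') = g \<cdot> f - g \<cdot> f'"
  using compose_add_right[OF assms(1) Hom_diff[OF assms(2,3)] assms(3)]
  by (simp add: algebra_simps)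

lemma compose_sum_left:
  assumes "\<And>j. j \<in> I \<Longrightarrow> g j \<in> Hom C Y W" "f \<in> Hom C X Y"
  shows "(\<Sum>j\<in>I. g j) \<cdot> f = (\<Sum>j\<in>I. g j \<cdot> f)"
  using assms
proof (induction I rule: infinite_finite_induct)
  case (insert x F)
  then have "(g x + (\<Sum>j\<in>F. g j)) \<cdot> f = g x \<cdot> f + (\<Sum>j\<in>F. g j) \<cdot> f"
    by (intro compose_add_left Hom_sum) auto
  with insert show ?case by simp
qed (auto simp: compose_zero_left)

lemma compose_sum_right:
  assumes "g \<in> Hom C Y W" "\<And>j. j \<in> I \<Longrightarrow> f j \<in> Hom C X Y"
  shows "g \<cdot> (\<Sum>j\<in>I. f j) = (\<Sum>j\<in>I. g \<cdot> f j)"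
  using assms
proof (induction I rule: infinite_finite_induct)
  case (insert x F)
  then have "g \<cdot> (f x + (\<Sum>j\<in>F. f j)) = g \<cdot> f x + g \<cdot> (\<Sum>j\<in>F. f j)"
    by (intro compose_add_right Hom_sum) auto
  with insert show ?case by simp
qed (auto simp: compose_zero_right)

lemma inverse_mor:
  assumes "is_iso C X Y f"
  shows "inverse_mor C X Y f \<in> Hom C Y X"
    and "inverse_mor C X Y f \<cdot> f = ident C X"
    and "f \<cdot> inverse_mor C X Y f = ident C Y"
proof -
  obtain g where f: "f \<in> Hom C X Y" and g: "g \<in> Hom C Y X" "g \<cdot> f = ident C X" "f \<cdot> g = ident C Y"
    using assms unfolding is_iso_def by blast
  have "h = g" if "h \<in> Hom C Y X" "h \<cdot> f = ident C X" for h
    using that f g compose_assoc[OF that(1) f g(1)] by (metis ident_left ident_right)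
  then have "\<exists>!g. g \<in> Hom C Y X \<and> g \<cdot> f = ident C X \<and> f \<cdot> g = ident C Y"
    using g by blast
  from theI'[OF this]
  show "inverse_mor C X Y f \<in> Hom C Y X" "inverse_mor C X Y f \<cdot> f = ident C X"
    "f \<cdot> inverse_mor C X Y f = ident C Y"
    unfolding inverse_mor_def by blast+
qed

lemma poly_endo_of_eigendecomposition:
  assumes "finite I" and a: "a \<in> Hom C X X" and e: "\<And>j. j \<in> I \<Longrightarrow> e j \<in> Hom C X X"
    and eig: "\<And>j. j \<in> I \<Longrightarrow> a \<cdot> e j = lam j \<odot> e j"
    and one: "(\<Sum>j\<in>I. e j) = ident C X"
    and v: "v \<in> Hom C W X"
  shows "poly_endo (scl C) F (\<lambda>f. a \<cdot> f) v = (\<Sum>j\<in>I. poly F (lam j) \<odot> (e j \<cdot> v))"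
proof -
  have ev: "e j \<cdot> v \<in> Hom C W X" if "j \<in> I" for j using that e v compose_in_Hom by blast
  have aev: "a \<cdot> (e j \<cdot> v) = lam j \<odot> (e j \<cdot> v)" if "j \<in> I" for j
    using compose_assoc[OF a e[OF that] v] eig[OF that] compose_scl_left[OF e[OF that] v] by simp
  have pow: "((\<lambda>f. a \<cdot> f) ^^ k) v = (\<Sum>j\<in>I. (lam j ^ k) \<odot> (e j \<cdot> v))" for k
  proof (induction k)
    case 0
    then show ?case using compose_sum_left[of I e X X, OF e v] one ident_left[OF v] by simp
  next
    case (Suc k)
    have "((\<lambda>f. a \<cdot> f) ^^ Suc k) v = (\<Sum>j\<in>I. a \<cdot> ((lam j ^ k) \<odot> (e j \<cdot> v)))"
      using Suc compose_sum_right[OF a, of I "\<lambda>j. (lam j ^ k) \<odot> (e j \<cdot> v)" W] Hom_scl[OF ev]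
      by simp
    also have "\<dots> = (\<Sum>j\<in>I. (lam j ^ Suc k) \<odot> (e j \<cdot> v))"
      by (intro sum.cong refl) (simp add: compose_scl_right[OF a ev] aev mult.commute)
    finally show ?case .
  qed
  have "poly_endo (scl C) F (\<lambda>f. a \<cdot> f) v =
      (\<Sum>k\<le>degree F. \<Sum>j\<in>I. (coeff F k * lam j ^ k) \<odot> (e j \<cdot> v))"
    unfolding poly_endo_def pow by (simp add: scale_sum_right)
  also have "\<dots> = (\<Sum>j\<in>I. poly F (lam j) \<odot> (e j \<cdot> v))"
    by (subst sum.swap) (simp add: poly_altdef scale_sum_left)
  finally show ?thesis .
qed

text \<open>\<open>P\<^sub>r\<close> vanishes at every eigenvalue except \<open>lam r\<close>, so just one summand survives.\<close>

lemma P_poly_endo_of_eigendecomposition: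
  assumes "a \<in> Hom C X X" and "\<And>j. j \<in> {1..d} \<Longrightarrow> e j \<in> Hom C X X"
    and "\<And>j. j \<in> {1..d} \<Longrightarrow> a \<cdot> e j = lam j \<odot> e j"
    and "(\<Sum>j\<in>{1..d}. e j) = ident C X"
    and "v \<in> Hom C W X" and r: "r \<in> {1..d}"
  shows "poly_endo (scl C) (P_poly d lam r) (\<lambda>f. a \<cdot> f) v =
    poly (P_poly d lam r) (lam r) \<odot> (e r \<cdot> v)"
proof -
  have "poly (P_poly d lam r) (lam j) = 0" if "j \<in> {1..d}" "j \<noteq> r" for j
    using that by (auto simp: P_poly_def poly_prod)
  then have "(\<Sum>j\<in>{1..d}. poly (P_poly d lam r) (lam j) \<odot> (e j \<cdot> v)) =
      (\<Sum>j\<in>{r}. poly (P_poly d lam r) (lam j) \<odot> (e j \<cdot> v))"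
    using r by (intro sum.mono_neutral_right) auto
  then show ?thesis
    using poly_endo_of_eigendecomposition[OF finite_atLeastAtMost assms(1-5)] by simp
qed

end


section \<open>Schur's lemma\<close>

text \<open>
  On \<open>S = X \<oplus> Y\<close> the morphism becomes an endomorphism \<open>F\<close>. A complement of the left ideal
  \<open>End(S) F\<close> splits the identity as \<open>l + l'\<close>, and \<open>F l' = F - F l\<close> lies in both ideals. So
  \<open>F = F l\<close>, where \<open>l\<close> is a left multiple of \<open>F\<close>.
\<close>

lemma (in semisimple_ribbon_category) von_neumann_regular:
  assumes f: "f \<in> Hom C X Y"
  shows "\<exists>g \<in> Hom C Y X. f \<cdot> g \<cdot> f = f"
proof -
  obtain S inc prj where "direct_sum C S {..<2::nat} (\<lambda>k. if k = 0 then X else Y) inc prj"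
    using direct_sums_exist[of 2] by blast
  then have i0: "inc 0 \<in> Hom C X S" and r0: "prj 0 \<in> Hom C S X" and ri0: "prj 0 \<cdot> inc 0 = ident C X"
    and i1: "inc 1 \<in> Hom C Y S" and r1: "prj 1 \<in> Hom C S Y" and ri1: "prj 1 \<cdot> inc 1 = ident C Y"
    unfolding direct_sum_def by (auto simp: numeral_2_eq_2 lessThan_Suc)
  define F where "F = inc 1 \<cdot> f \<cdot> prj 0"
  have fr: "f \<cdot> prj 0 \<in> Hom C S Y" using f r0 compose_in_Hom by blast
  have F: "F \<in> Hom C S S" unfolding F_def using fr i1 compose_in_Hom by blast
  have Fi: "F \<cdot> inc 0 = inc 1 \<cdot> f"
    unfolding F_def compose_assoc[OF i1 fr i0] compose_assoc[OF f r0 i0] ri0 ident_right[OF f] ..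
  have rF: "prj 1 \<cdot> F = f \<cdot> prj 0"
    unfolding F_def compose_assoc[OF r1 i1 fr, symmetric] ri1 ident_left[OF fr] ..
  define L where "L = (\<lambda>a. a \<cdot> F) ` Hom C S S"
  have "subspace L"
  proof (rule subspaceI)
    show "0 \<in> L" unfolding L_def using compose_zero_left[OF F] Hom_zero by (metis image_eqI)
    show "x + y \<in> L" if xy: "x \<in> L" "y \<in> L" for x y
    proof -
      obtain a b where ab: "a \<in> Hom C S S" "b \<in> Hom C S S" "x = a \<cdot> F" "y = b \<cdot> F"
        using xy unfolding L_def by blast
      have "x + y = (a + b) \<cdot> F" using ab compose_add_left[OF _ _ F] by simp
      then show ?thesis unfolding L_def using Hom_add[OF ab(1,2)] by blast
    qed
    show "c \<odot> x \<in> L" if x: "x \<in> L" for c x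
    proof -
      obtain a where a: "a \<in> Hom C S S" "x = a \<cdot> F" using x unfolding L_def by blast
      have "c \<odot> x = (c \<odot> a) \<cdot> F" using a compose_scl_left[OF _ F] by simp
      then show ?thesis unfolding L_def using Hom_scl[OF a(1)] by blast
    qed
  qed
  have LH: "L \<subseteq> Hom C S S" unfolding L_def using compose_in_Hom[OF _ F] by blast
  have Lmult: "a \<cdot> x \<in> L" if a: "a \<in> Hom C S S" and x: "x \<in> L" for a x
  proof -
    obtain b where b: "b \<in> Hom C S S" "x = b \<cdot> F" using x unfolding L_def by blast
    have "a \<cdot> x = (a \<cdot> b) \<cdot> F" using compose_assoc[OF a b(1) F] b(2) by simp
    then show ?thesis unfolding L_def using compose_in_Hom[OF a b(1)] by blast
  qed
  have L: "left_ideal_End C S L"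
    unfolding left_ideal_End_def using \<open>subspace L\<close> LH Lmult by (intro conjI ballI)
  obtain L' where L': "left_ideal_End C S L'" and disj: "L \<inter> L' = {0}"
    and sum: "\<forall>h \<in> Hom C S S. \<exists>l\<in>L. \<exists>l'\<in>L'. h = l + l'"
    using End_semisimple[of S, unfolded semisimple_End_def, rule_format, OF L] by auto
  obtain l l' where l: "l \<in> L" "l' \<in> L'" and one: "ident C S = l + l'"
    using bspec[OF sum ident_in_Hom] by blast
  have lH: "l \<in> Hom C S S" "l' \<in> Hom C S S"
    using l L L' unfolding left_ideal_End_def by auto
  have "F \<cdot> l' = F - F \<cdot> l"
    using compose_add_right[OF F lH] one ident_right[OF F] by (simp add: algebra_simps)
  moreover have "F \<cdot> l \<in> L" "F \<cdot> l' \<in> L'" using l L L' F unfolding left_ideal_End_def by auto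
  moreover have "F \<in> L" unfolding L_def using ident_left[OF F] ident_in_Hom by (metis image_eqI)
  ultimately have "F \<cdot> l' \<in> L \<inter> L'" using \<open>subspace L\<close> subspace_diff by auto
  with disj \<open>F \<cdot> l' = F - F \<cdot> l\<close> have "F = F \<cdot> l" by simp
  then obtain a where a: "a \<in> Hom C S S" and FaF: "F = F \<cdot> a \<cdot> F"
    using l(1) unfolding L_def by auto
  let ?g = "prj 0 \<cdot> a \<cdot> inc 1"
  have ai: "a \<cdot> inc 1 \<in> Hom C Y S" using a i1 compose_in_Hom by blast
  have g: "?g \<in> Hom C Y X" using ai r0 compose_in_Hom by blast
  have aF: "a \<cdot> F \<in> Hom C S S" using a F compose_in_Hom by blast
  have "f = prj 1 \<cdot> F \<cdot> inc 0"
    unfolding Fi compose_assoc[OF r1 i1 f, symmetric] ri1 ident_left[OF f] ..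
  also have "\<dots> = prj 1 \<cdot> (F \<cdot> a \<cdot> F) \<cdot> inc 0" using FaF by simp
  also have "\<dots> = (prj 1 \<cdot> F) \<cdot> a \<cdot> (F \<cdot> inc 0)"
    unfolding compose_assoc[OF F aF i0] compose_assoc[OF a F i0]
    by (rule compose_assoc[OF r1 F compose_in_Hom[OF a compose_in_Hom[OF F i0]], symmetric])
  also have "\<dots> = f \<cdot> ?g \<cdot> f"
    unfolding Fi rF compose_assoc[OF r0 ai f] compose_assoc[OF a i1 f]
    by (rule compose_assoc[OF f r0 compose_in_Hom[OF a compose_in_Hom[OF i1 f]]])
  finally show ?thesis using g by metis
qed

text \<open>A splitting of \<open>e\<close> has a split, hence monic, inclusion into the simple object \<open>X\<close>.\<close>

lemma (in semisimple_ribbon_category) simple_idempotent: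
  assumes X: "simple_object C X" and e: "e \<in> Hom C X X" "e \<cdot> e = e" "e \<noteq> 0"
  shows "e = ident C X"
proof -
  obtain W i r where i: "i \<in> Hom C W X" and r: "r \<in> Hom C X W"
    and ri: "r \<cdot> i = ident C W" and eir: "e = i \<cdot> r"
    using idempotents_split[OF e(1,2)] unfolding projection_onto_def by blast
  have "g = r \<cdot> i \<cdot> g" if "g \<in> Hom C V W" for V g
    using compose_assoc[OF r i that] ri ident_left[OF that] by simp
  then have "is_mono C W X i"
    unfolding is_mono_def using i by metis
  moreover have "i \<noteq> 0" using e(3) eir compose_zero_left[OF r] by auto
  ultimately have "is_iso C W X i" using X unfolding simple_object_def by blast
  then obtain g where g: "g \<in> Hom C X W" "i \<cdot> g = ident C X" unfolding is_iso_def by blast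
  have "r = g" using compose_assoc[OF r i g(1)] ri g ident_left[OF g(1)] ident_right[OF r] by simp
  with g eir show ?thesis by simp
qed

lemma (in semisimple_ribbon_category) simple_nonzero_is_iso:
  assumes X: "simple_object C X" and Y: "simple_object C Y"
    and f: "f \<in> Hom C X Y" "f \<noteq> 0"
  shows "is_iso C X Y f"
proof -
  obtain g where g: "g \<in> Hom C Y X" and fgf: "f \<cdot> g \<cdot> f = f"
    using von_neumann_regular[OF f(1)] by blast
  have gf: "g \<cdot> f \<in> Hom C X X" and fg: "f \<cdot> g \<in> Hom C Y Y"
    using f(1) g compose_in_Hom by auto
  have fgf': "(f \<cdot> g) \<cdot> f = f" using compose_assoc[OF f(1) g f(1)] fgf by simp
  have "g \<cdot> f \<noteq> 0" using fgf f compose_zero_right[OF f(1)] by auto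
  moreover have "(g \<cdot> f) \<cdot> (g \<cdot> f) = g \<cdot> f"
    using compose_assoc[OF g f(1) gf] fgf by simp
  ultimately have "g \<cdot> f = ident C X" using simple_idempotent[OF X gf] by blast
  have "f \<cdot> g \<noteq> 0" using fgf' f compose_zero_left[OF f(1)] by auto
  moreover have "(f \<cdot> g) \<cdot> (f \<cdot> g) = f \<cdot> g"
    using compose_assoc[OF fg f(1) g] fgf' by simp
  ultimately have "f \<cdot> g = ident C Y" using simple_idempotent[OF Y fg] by blast
  with \<open>g \<cdot> f = ident C X\<close> f g show ?thesis unfolding is_iso_def by blast
qed

text \<open>
  Left composition with \<open>f\<close> on the finite-dimensional space \<open>End(X)\<close> has an eigenvector \<open>g\<close>,
  that is, \<open>f - a\<close> annihilates a nonzero endomorphism; being zero or invertible, it is zero.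
\<close>

lemma (in semisimple_ribbon_category) simple_End_scalar:
  assumes X: "simple_object C X" and f: "f \<in> Hom C X X"
  shows "\<exists>a. f = a \<odot> ident C X"
proof -
  let ?T = "\<lambda>g. f \<cdot> g"
  obtain B where B: "finite B" "Hom C X X = span B" using Hom_finite_dim by blast
  have pow: "(?T ^^ i) (ident C X) \<in> span B" for i
    unfolding B(2)[symmetric] by (induction i) (auto simp: ident_in_Hom compose_in_Hom[OF f])
  obtain F where F: "F \<noteq> 0" "poly_endo (scl C) F ?T (ident C X) = 0"
    using annihilating_polynomial_exists[OF B(1) pow] by blast
  have "\<exists>a. \<exists>g \<in> Hom C X X. g \<noteq> 0 \<and> f \<cdot> g = a \<odot> g"
  proof (rule eigenvector_if_annihilated[OF _ Hom_subspace _ _ _ ident_in_Hom _ F])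
    show "ident C X \<noteq> 0" using X unfolding simple_object_def by blast
  qed (fact alg_closed_imp_poly_has_root compose_in_Hom[OF f] compose_diff_right[OF f]
      compose_scl_right[OF f])+
  then obtain a g where g: "g \<in> Hom C X X" "g \<noteq> 0" and eig: "f \<cdot> g = a \<odot> g" by blast
  let ?h = "f - a \<odot> ident C X"
  have a1: "a \<odot> ident C X \<in> Hom C X X" by (intro Hom_scl ident_in_Hom)
  have h: "?h \<in> Hom C X X" using f a1 Hom_diff by blast
  have hg: "?h \<cdot> g = 0"
    using compose_diff_left[OF f a1 g(1)] eig compose_scl_left[OF ident_in_Hom g(1)] ident_left[OF g(1)]
    by simp
  have "?h = 0"
  proof (rule ccontr)
    assume "?h \<noteq> 0"
    then obtain k where k: "k \<in> Hom C X X" "k \<cdot> ?h = ident C X"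
      using simple_nonzero_is_iso[OF X X h] unfolding is_iso_def by blast
    have "g = k \<cdot> ?h \<cdot> g" using compose_assoc[OF k(1) h g(1)] k(2) ident_left[OF g(1)] by simp
    then show False using hg compose_zero_right[OF k(1)] g(2) by simp
  qed
  then show ?thesis by auto
qed

section \<open>Endomorphisms of the tensor cube\<close>

context linear_monoidal_category
begin

lemma on12_in_Hom: "a \<in> Hom C (Z \<otimes> Z) (Z \<otimes> Z) \<Longrightarrow> on12 C Z a \<in> Hom C (cube C Z) (cube C Z)"
  unfolding on12_def cube_def by (intro tens_in_Hom ident_in_Hom)

lemma on12_compose:
  assumes "a \<in> Hom C (Z \<otimes> Z) (Z \<otimes> Z)" "b \<in> Hom C (Z \<otimes> Z) (Z \<otimes> Z)"
  shows "on12 C Z (a \<cdot> b) = on12 C Z a \<cdot> on12 C Z b"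
  using interchange[OF assms(2,1) ident_in_Hom ident_in_Hom, of Z] ident_left[OF ident_in_Hom, of Z]
  unfolding on12_def by simp

lemma on12_ident: "on12 C Z (ident C (Z \<otimes> Z)) = ident C (cube C Z)"
  unfolding on12_def cube_def by (rule tens_ident)

lemma on12_add:
  "a \<in> Hom C (Z \<otimes> Z) (Z \<otimes> Z) \<Longrightarrow> b \<in> Hom C (Z \<otimes> Z) (Z \<otimes> Z) \<Longrightarrow>
    on12 C Z (a + b) = on12 C Z a + on12 C Z b"
  unfolding on12_def by (rule tens_add_left[OF _ _ ident_in_Hom])

lemma on12_scl:
  "a \<in> Hom C (Z \<otimes> Z) (Z \<otimes> Z) \<Longrightarrow> on12 C Z (s \<odot> a) = s \<odot> on12 C Z a"
  unfolding on12_def by (rule tens_scl_left[OF _ ident_in_Hom])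

lemmas assoc_in_Hom = assoc_iso[unfolded is_iso_def, THEN conjunct1]
lemmas assoc_inv_in_Hom = inverse_mor(1)[OF assoc_iso]

lemma ident_tens_in_Hom: "a \<in> Hom C X Y \<Longrightarrow> ident C Z \<boxtimes> a \<in> Hom C (Z \<otimes> X) (Z \<otimes> Y)"
  by (intro tens_in_Hom ident_in_Hom)

lemma on23_in_Hom: "a \<in> Hom C (Z \<otimes> Z) (Z \<otimes> Z) \<Longrightarrow> on23 C Z a \<in> Hom C (cube C Z) (cube C Z)"
  unfolding on23_def cube_def
  by (rule compose_in_Hom[OF assoc_inv_in_Hom compose_in_Hom[OF ident_tens_in_Hom assoc_in_Hom]])

lemma assoc_on23:
  assumes a: "a \<in> Hom C (Z \<otimes> Z) (Z \<otimes> Z)"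
  shows "assoc C Z Z Z \<cdot> on23 C Z a = (ident C Z \<boxtimes> a) \<cdot> assoc C Z Z Z"
proof -
  have b: "(ident C Z \<boxtimes> a) \<cdot> assoc C Z Z Z \<in> Hom C ((Z \<otimes> Z) \<otimes> Z) (Z \<otimes> (Z \<otimes> Z))"
    using a by (intro compose_in_Hom[OF ident_tens_in_Hom assoc_in_Hom])
  show ?thesis
    unfolding on23_def compose_assoc[OF assoc_in_Hom assoc_inv_in_Hom b, symmetric]
      inverse_mor(3)[OF assoc_iso] by (rule ident_left[OF b])
qed

lemma on23_compose:
  assumes a: "a \<in> Hom C (Z \<otimes> Z) (Z \<otimes> Z)" and b: "b \<in> Hom C (Z \<otimes> Z) (Z \<otimes> Z)"
  shows "on23 C Z (a \<cdot> b) = on23 C Z a \<cdot> on23 C Z b"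
proof -
  let ?\<alpha> = "assoc C Z Z Z" and ?\<beta> = "assoc_inv C Z Z Z" and ?a = "ident C Z \<boxtimes> a" and ?b = "ident C Z \<boxtimes> b"
  note a' = ident_tens_in_Hom[OF a, of Z] and b' = ident_tens_in_Hom[OF b, of Z]
  have b2: "on23 C Z b \<in> Hom C ((Z \<otimes> Z) \<otimes> Z) ((Z \<otimes> Z) \<otimes> Z)"
    using on23_in_Hom[OF b] unfolding cube_def .
  have "on23 C Z (a \<cdot> b) = ?\<beta> \<cdot> (?a \<cdot> ?b) \<cdot> ?\<alpha>"
    unfolding on23_def using interchange[OF ident_in_Hom ident_in_Hom b a, of Z]
      ident_left[OF ident_in_Hom, of Z] by simp
  also have "\<dots> = ?\<beta> \<cdot> ?a \<cdot> (?\<alpha> \<cdot> on23 C Z b)"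
    by (simp add: compose_assoc[OF a' b' assoc_in_Hom] assoc_on23[OF b])
  also have "\<dots> = on23 C Z a \<cdot> on23 C Z b"
    unfolding on23_def[where a = a]
    by (simp add: compose_assoc[OF assoc_inv_in_Hom compose_in_Hom[OF a' assoc_in_Hom] b2]
        compose_assoc[OF a' assoc_in_Hom b2])
  finally show ?thesis .
qed

lemma on23_ident: "on23 C Z (ident C (Z \<otimes> Z)) = ident C (cube C Z)"
  unfolding on23_def cube_def tens_ident ident_left[OF assoc_in_Hom]
  by (rule inverse_mor(2)[OF assoc_iso])

lemma on23_add:
  assumes a: "a \<in> Hom C (Z \<otimes> Z) (Z \<otimes> Z)" and b: "b \<in> Hom C (Z \<otimes> Z) (Z \<otimes> Z)"
  shows "on23 C Z (a + b) = on23 C Z a + on23 C Z b"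
  unfolding on23_def tens_add_right[OF ident_in_Hom a b]
    compose_add_left[OF ident_tens_in_Hom[OF a] ident_tens_in_Hom[OF b] assoc_in_Hom]
  by (rule compose_add_right[OF assoc_inv_in_Hom compose_in_Hom[OF ident_tens_in_Hom[OF a] assoc_in_Hom]
        compose_in_Hom[OF ident_tens_in_Hom[OF b] assoc_in_Hom]])

lemma on23_scl:
  assumes a: "a \<in> Hom C (Z \<otimes> Z) (Z \<otimes> Z)"
  shows "on23 C Z (s \<odot> a) = s \<odot> on23 C Z a"
  unfolding on23_def tens_scl_right[OF ident_in_Hom a]
    compose_scl_left[OF ident_tens_in_Hom[OF a] assoc_in_Hom]
  by (rule compose_scl_right[OF assoc_inv_in_Hom compose_in_Hom[OF ident_tens_in_Hom[OF a] assoc_in_Hom]])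

lemma on12_sum:
  assumes "finite I" "\<And>j. j \<in> I \<Longrightarrow> a j \<in> Hom C (Z \<otimes> Z) (Z \<otimes> Z)"
  shows "on12 C Z (\<Sum>j\<in>I. a j) = (\<Sum>j\<in>I. on12 C Z (a j))"
  using assms
proof (induction I rule: finite_induct)
  case empty
  then show ?case using on12_scl[OF Hom_zero, of Z 0] by simp
next
  case (insert x F)
  then have "on12 C Z (a x + (\<Sum>j\<in>F. a j)) = on12 C Z (a x) + on12 C Z (\<Sum>j\<in>F. a j)"
    by (intro on12_add Hom_sum) auto
  with insert show ?case by simp
qed

lemma on23_sum:
  assumes "finite I" "\<And>j. j \<in> I \<Longrightarrow> a j \<in> Hom C (Z \<otimes> Z) (Z \<otimes> Z)"
  shows "on23 C Z (\<Sum>j\<in>I. a j) = (\<Sum>j\<in>I. on23 C Z (a j))"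
  using assms
proof (induction I rule: finite_induct)
  case empty
  then show ?case using on23_scl[OF Hom_zero, of Z 0] by simp
next
  case (insert x F)
  then have "on23 C Z (a x + (\<Sum>j\<in>F. a j)) = on23 C Z (a x) + on23 C Z (\<Sum>j\<in>F. a j)"
    by (intro on23_add Hom_sum) auto
  with insert show ?case by simp
qed

text \<open>
  If \<open>p = i \<cdot> r\<close> with \<open>r \<cdot> i = 1\<close>, the canonical map \<open>Z \<cong> \<one> \<otimes> Z \<rightarrow> Z\<^sup>3\<close> given by \<open>i \<otimes> 1\<close> is fixed
  by \<open>p \<otimes> 1\<close>. This makes \<open>P\<^sub>1(A)\<close> nonzero, hence the scalar \<open>Q\<close> unique.
\<close>

lemma on12_summand_nonzero:
  assumes Z: "ident C Z \<noteq> 0" and p: "projection_onto C (Z \<otimes> Z) \<one> p"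
  shows "\<exists>v \<in> Hom C Z (cube C Z). on12 C Z p \<cdot> v \<noteq> 0"
proof -
  obtain i r where i: "i \<in> Hom C \<one> (Z \<otimes> Z)" and r: "r \<in> Hom C (Z \<otimes> Z) \<one>"
    and ri: "r \<cdot> i = ident C \<one>" and pir: "p = i \<cdot> r"
    using p unfolding projection_onto_def by blast
  have pi: "p \<cdot> i = i" using compose_assoc[OF i r i] ri ident_right[OF i] pir by simp
  have pH: "p \<in> Hom C (Z \<otimes> Z) (Z \<otimes> Z)" unfolding pir using compose_in_Hom[OF i r] .
  let ?l = "inverse_mor C (\<one> \<otimes> Z) Z (lunit C Z)"
  note l = inverse_mor[OF lunit_iso[of Z]]
  have i1: "i \<boxtimes> ident C Z \<in> Hom C (\<one> \<otimes> Z) (cube C Z)"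
    unfolding cube_def by (intro tens_in_Hom i ident_in_Hom)
  have r1: "r \<boxtimes> ident C Z \<in> Hom C (cube C Z) (\<one> \<otimes> Z)"
    unfolding cube_def by (intro tens_in_Hom r ident_in_Hom)
  let ?v = "(i \<boxtimes> ident C Z) \<cdot> ?l"
  have v: "?v \<in> Hom C Z (cube C Z)" using compose_in_Hom[OF i1 l(1)] .
  have "on12 C Z p \<cdot> ?v = (on12 C Z p \<cdot> (i \<boxtimes> ident C Z)) \<cdot> ?l"
    by (rule compose_assoc[OF on12_in_Hom[OF pH] i1 l(1), symmetric])
  also have "on12 C Z p \<cdot> (i \<boxtimes> ident C Z) = i \<boxtimes> ident C Z"
    using interchange[OF i pH ident_in_Hom ident_in_Hom, of Z] ident_left[OF ident_in_Hom, of Z]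
    by (simp add: on12_def pi)
  finally have pv: "on12 C Z p \<cdot> ?v = ?v" .
  have "(r \<boxtimes> ident C Z) \<cdot> ?v = ((r \<boxtimes> ident C Z) \<cdot> (i \<boxtimes> ident C Z)) \<cdot> ?l"
    by (rule compose_assoc[OF r1 i1 l(1), symmetric])
  also have "(r \<boxtimes> ident C Z) \<cdot> (i \<boxtimes> ident C Z) = ident C (\<one> \<otimes> Z)"
    using interchange[OF i r ident_in_Hom ident_in_Hom, of Z] ident_left[OF ident_in_Hom, of Z]
    by (simp add: ri tens_ident)
  finally have rv: "(r \<boxtimes> ident C Z) \<cdot> ?v = ?l" by (simp add: ident_left[OF l(1)])
  have "?v \<noteq> 0"
  proof
    assume "?v = 0"
    then have "?l = 0" using rv compose_zero_right[OF r1] by simp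
    then show False
      using l(3) Z compose_zero_right[of "lunit C Z"] lunit_iso[of Z] unfolding is_iso_def by metis
  qed
  with pv v show ?thesis by (intro bexI[of _ ?v]) simp_all
qed

end

section \<open>The half twist\<close>

context linear_braided_category
begin

lemmas braiding_in_Hom = braiding_iso[unfolded is_iso_def, THEN conjunct1]

text \<open>
  By the hexagons, \<open>c\<^sub>2 c\<^sub>1\<close> and \<open>c\<^sub>1 c\<^sub>2\<close> are, up to associativity, the braiding of \<open>Z\<close> past
  \<open>Z \<otimes> Z\<close> and of \<open>Z \<otimes> Z\<close> past \<open>Z\<close>. Naturality then moves an arbitrary endomorphism of \<open>Z \<otimes> Z\<close>
  from one pair of strands to the other.
\<close>

lemma on23_braiding_on12_braiding:
  "on23 C Z (braiding C Z Z) \<cdot> on12 C Z (braiding C Z Z) = braiding C Z (Z \<otimes> Z) \<cdot> assoc C Z Z Z"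
proof -
  let ?\<alpha> = "assoc C Z Z Z" and ?\<beta> = "assoc_inv C Z Z Z" and ?c = "braiding C Z Z"
  note c = braiding_in_Hom[of Z Z]
  have b: "braiding C Z (Z \<otimes> Z) \<cdot> ?\<alpha> \<in> Hom C ((Z \<otimes> Z) \<otimes> Z) ((Z \<otimes> Z) \<otimes> Z)"
    by (rule compose_in_Hom[OF braiding_in_Hom assoc_in_Hom])
  have c1: "on12 C Z ?c \<in> Hom C ((Z \<otimes> Z) \<otimes> Z) ((Z \<otimes> Z) \<otimes> Z)"
    using on12_in_Hom[OF c] unfolding cube_def .
  have "braiding C Z (Z \<otimes> Z) \<cdot> ?\<alpha> = ?\<beta> \<cdot> (?\<alpha> \<cdot> braiding C Z (Z \<otimes> Z) \<cdot> ?\<alpha>)"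
    using compose_assoc[OF assoc_inv_in_Hom assoc_in_Hom b] inverse_mor(2)[OF assoc_iso]
      ident_left[OF b] by simp
  also have "\<dots> = ?\<beta> \<cdot> (ident C Z \<boxtimes> ?c) \<cdot> ?\<alpha> \<cdot> on12 C Z ?c"
    unfolding hexagon1 on12_def ..
  also have "\<dots> = on23 C Z ?c \<cdot> on12 C Z ?c"
    unfolding on23_def
      compose_assoc[OF assoc_inv_in_Hom compose_in_Hom[OF ident_tens_in_Hom[OF c] assoc_in_Hom] c1]
      compose_assoc[OF ident_tens_in_Hom[OF c] assoc_in_Hom c1] ..
  finally show ?thesis ..
qed

lemma on12_braiding_on23_braiding:
  "on12 C Z (braiding C Z Z) \<cdot> on23 C Z (braiding C Z Z) = assoc_inv C Z Z Z \<cdot> braiding C (Z \<otimes> Z) Z"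
proof -
  let ?\<alpha> = "assoc C Z Z Z" and ?\<beta> = "assoc_inv C Z Z Z" and ?c = "braiding C Z Z"
  let ?b = "braiding C (Z \<otimes> Z) Z"
  note c = braiding_in_Hom[of Z Z]
  note c' = ident_tens_in_Hom[OF c, of Z]
  have b: "?b \<in> Hom C ((Z \<otimes> Z) \<otimes> Z) (Z \<otimes> (Z \<otimes> Z))" by (rule braiding_in_Hom)
  have c1: "on12 C Z ?c \<in> Hom C ((Z \<otimes> Z) \<otimes> Z) ((Z \<otimes> Z) \<otimes> Z)"
    using on12_in_Hom[OF c] unfolding cube_def .
  have "?\<beta> \<cdot> ?b = (?\<beta> \<cdot> ?b \<cdot> ?\<beta>) \<cdot> ?\<alpha>"
    unfolding compose_assoc[OF assoc_inv_in_Hom compose_in_Hom[OF b assoc_inv_in_Hom] assoc_in_Hom]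
      compose_assoc[OF b assoc_inv_in_Hom assoc_in_Hom] inverse_mor(2)[OF assoc_iso] ident_right[OF b] ..
  also have "\<dots> = (on12 C Z ?c \<cdot> ?\<beta> \<cdot> (ident C Z \<boxtimes> ?c)) \<cdot> ?\<alpha>"
    unfolding hexagon2 on12_def ..
  also have "\<dots> = on12 C Z ?c \<cdot> on23 C Z ?c"
    unfolding on23_def
      compose_assoc[OF c1 compose_in_Hom[OF assoc_inv_in_Hom c'] assoc_in_Hom]
      compose_assoc[OF assoc_inv_in_Hom c' assoc_in_Hom] ..
  finally show ?thesis ..
qed

lemma braid_on23:
  assumes a: "a \<in> Hom C (Z \<otimes> Z) (Z \<otimes> Z)"
  shows "(on23 C Z (braiding C Z Z) \<cdot> on12 C Z (braiding C Z Z)) \<cdot> on23 C Z a =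
    on12 C Z a \<cdot> (on23 C Z (braiding C Z Z) \<cdot> on12 C Z (braiding C Z Z))"
proof -
  let ?\<alpha> = "assoc C Z Z Z" and ?b = "braiding C Z (Z \<otimes> Z)"
  have a1: "on12 C Z a \<in> Hom C ((Z \<otimes> Z) \<otimes> Z) ((Z \<otimes> Z) \<otimes> Z)"
    using on12_in_Hom[OF a] unfolding cube_def .
  have a2: "on23 C Z a \<in> Hom C ((Z \<otimes> Z) \<otimes> Z) ((Z \<otimes> Z) \<otimes> Z)"
    using on23_in_Hom[OF a] unfolding cube_def .
  have "(?b \<cdot> ?\<alpha>) \<cdot> on23 C Z a = ?b \<cdot> (ident C Z \<boxtimes> a) \<cdot> ?\<alpha>"
    unfolding compose_assoc[OF braiding_in_Hom assoc_in_Hom a2] assoc_on23[OF a] ..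
  also have "\<dots> = (?b \<cdot> (ident C Z \<boxtimes> a)) \<cdot> ?\<alpha>"
    by (rule compose_assoc[OF braiding_in_Hom ident_tens_in_Hom[OF a] assoc_in_Hom, symmetric])
  also have "\<dots> = (on12 C Z a \<cdot> ?b) \<cdot> ?\<alpha>"
    unfolding braiding_natural[OF ident_in_Hom a] on12_def ..
  also have "\<dots> = on12 C Z a \<cdot> ?b \<cdot> ?\<alpha>"
    by (rule compose_assoc[OF a1 braiding_in_Hom assoc_in_Hom])
  finally show ?thesis unfolding on23_braiding_on12_braiding .
qed

lemma braid_on12:
  assumes a: "a \<in> Hom C (Z \<otimes> Z) (Z \<otimes> Z)"
  shows "(on12 C Z (braiding C Z Z) \<cdot> on23 C Z (braiding C Z Z)) \<cdot> on12 C Z a =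
    on23 C Z a \<cdot> (on12 C Z (braiding C Z Z) \<cdot> on23 C Z (braiding C Z Z))"
proof -
  let ?\<alpha> = "assoc C Z Z Z" and ?\<beta> = "assoc_inv C Z Z Z" and ?b = "braiding C (Z \<otimes> Z) Z"
  note a' = ident_tens_in_Hom[OF a, of Z]
  have b: "?b \<in> Hom C ((Z \<otimes> Z) \<otimes> Z) (Z \<otimes> (Z \<otimes> Z))" by (rule braiding_in_Hom)
  have a1: "on12 C Z a \<in> Hom C ((Z \<otimes> Z) \<otimes> Z) ((Z \<otimes> Z) \<otimes> Z)"
    using on12_in_Hom[OF a] unfolding cube_def .
  have bb: "?\<beta> \<cdot> ?b \<in> Hom C ((Z \<otimes> Z) \<otimes> Z) ((Z \<otimes> Z) \<otimes> Z)"
    by (rule compose_in_Hom[OF assoc_inv_in_Hom b])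
  have "(?\<beta> \<cdot> ?b) \<cdot> on12 C Z a = ?\<beta> \<cdot> (ident C Z \<boxtimes> a) \<cdot> ?b"
    unfolding compose_assoc[OF assoc_inv_in_Hom b a1]
    unfolding on12_def braiding_natural[OF a ident_in_Hom] ..
  also have "\<dots> = ?\<beta> \<cdot> (ident C Z \<boxtimes> a) \<cdot> (?\<alpha> \<cdot> ?\<beta> \<cdot> ?b)"
    unfolding compose_assoc[OF assoc_in_Hom assoc_inv_in_Hom b, symmetric]
      inverse_mor(3)[OF assoc_iso] ident_left[OF b] ..
  also have "\<dots> = on23 C Z a \<cdot> (?\<beta> \<cdot> ?b)"
    unfolding on23_def compose_assoc[OF assoc_inv_in_Hom compose_in_Hom[OF a' assoc_in_Hom] bb]
      compose_assoc[OF a' assoc_in_Hom bb] ..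
  finally show ?thesis unfolding on12_braiding_on23_braiding .
qed

text \<open>
  Each of \<open>c\<^sub>1 c\<^sub>2\<close> and \<open>c\<^sub>2 c\<^sub>1\<close> exchanges the two actions in one direction. The half twist is
  \<open>(c\<^sub>1 c\<^sub>2) c\<^sub>1 = c\<^sub>1 (c\<^sub>2 c\<^sub>1)\<close>; the extra factor \<open>c\<^sub>1\<close> commutes with \<open>a\<^sub>1\<close>, so that it exchanges them
  in both directions.
\<close>

lemma half_twist_conjugation:
  fixes Z :: 'o
  defines "\<Delta> \<equiv> on12 C Z (braiding C Z Z) \<cdot> on23 C Z (braiding C Z Z) \<cdot> on12 C Z (braiding C Z Z)"
  assumes a: "a \<in> Hom C (Z \<otimes> Z) (Z \<otimes> Z)" and comm: "braiding C Z Z \<cdot> a = a \<cdot> braiding C Z Z"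
  shows "\<Delta> \<cdot> on12 C Z a = on23 C Z a \<cdot> \<Delta>" and "\<Delta> \<cdot> on23 C Z a = on12 C Z a \<cdot> \<Delta>"
proof -
  let ?K = "cube C Z"
  let ?c1 = "on12 C Z (braiding C Z Z)" and ?c2 = "on23 C Z (braiding C Z Z)"
  let ?a1 = "on12 C Z a" and ?a2 = "on23 C Z a"
  note c = braiding_in_Hom[of Z Z]
  note H = on12_in_Hom[OF a] on12_in_Hom[OF c] on23_in_Hom[OF a] on23_in_Hom[OF c]
  note assoc = compose_assoc[where V = ?K and W = ?K and X = ?K and Y = ?K]
  note mult = compose_in_Hom[where W = ?K and X = ?K and Y = ?K]
  have ca: "?c1 \<cdot> ?a1 = ?a1 \<cdot> ?c1"
    using on12_compose[OF c a] on12_compose[OF a c] comm by simp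
  have "\<Delta> \<cdot> ?a1 = ?c1 \<cdot> ?c2 \<cdot> (?c1 \<cdot> ?a1)"
    unfolding \<Delta>_def by (simp add: assoc mult H)
  also have "\<dots> = ((?c1 \<cdot> ?c2) \<cdot> ?a1) \<cdot> ?c1"
    unfolding ca by (simp add: assoc mult H)
  also have "\<dots> = ?a2 \<cdot> \<Delta>"
    unfolding braid_on12[OF a] \<Delta>_def by (simp add: assoc mult H)
  finally show "\<Delta> \<cdot> ?a1 = ?a2 \<cdot> \<Delta>" .
  have "\<Delta> \<cdot> ?a2 = ?c1 \<cdot> ((?c2 \<cdot> ?c1) \<cdot> ?a2)"
    unfolding \<Delta>_def by (simp add: assoc mult H)
  also have "\<dots> = (?c1 \<cdot> ?a1) \<cdot> (?c2 \<cdot> ?c1)"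
    unfolding braid_on23[OF a] by (simp add: assoc mult H)
  also have "\<dots> = ?a1 \<cdot> \<Delta>"
    unfolding ca \<Delta>_def by (simp add: assoc mult H)
  finally show "\<Delta> \<cdot> ?a2 = ?a1 \<cdot> \<Delta>" .
qed

text \<open>Conjugate by the half twist and cancel it on the left.\<close>

lemma sandwich_exchange:
  assumes a: "a \<in> Hom C (Z \<otimes> Z) (Z \<otimes> Z)" "braiding C Z Z \<cdot> a = a \<cdot> braiding C Z Z"
    and b: "b \<in> Hom C (Z \<otimes> Z) (Z \<otimes> Z)" "braiding C Z Z \<cdot> b = b \<cdot> braiding C Z Z"
    and t: "on23 C Z a \<cdot> on12 C Z b \<cdot> on23 C Z a = t \<odot> on23 C Z a"
  shows "on12 C Z a \<cdot> on23 C Z b \<cdot> on12 C Z a = t \<odot> on12 C Z a"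
proof -
  let ?K = "cube C Z"
  let ?c1 = "on12 C Z (braiding C Z Z)" and ?c2 = "on23 C Z (braiding C Z Z)"
  define \<Delta> where "\<Delta> = ?c1 \<cdot> ?c2 \<cdot> ?c1"
  note c = braiding_in_Hom[of Z Z]
  obtain g where g: "g \<in> Hom C (Z \<otimes> Z) (Z \<otimes> Z)" and gc: "g \<cdot> braiding C Z Z = ident C (Z \<otimes> Z)"
    using braiding_iso[of Z Z] unfolding is_iso_def by blast
  note H = on12_in_Hom[OF a(1)] on12_in_Hom[OF b(1)] on12_in_Hom[OF c] on12_in_Hom[OF g]
    on23_in_Hom[OF a(1)] on23_in_Hom[OF b(1)] on23_in_Hom[OF c] on23_in_Hom[OF g]
  note assoc = compose_assoc[where V = ?K and W = ?K and X = ?K and Y = ?K]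
  note mult = compose_in_Hom[where W = ?K and X = ?K and Y = ?K]
  have \<Delta>: "\<Delta> \<in> Hom C ?K ?K" unfolding \<Delta>_def by (intro mult H)
  have cancel1: "on12 C Z g \<cdot> (?c1 \<cdot> x) = x" if "x \<in> Hom C ?K ?K" for x
    using on12_compose[OF g c] gc on12_ident[of Z] assoc[OF H(4) H(3) that] ident_left[OF that] by simp
  have cancel2: "on23 C Z g \<cdot> (?c2 \<cdot> x) = x" if "x \<in> Hom C ?K ?K" for x
    using on23_compose[OF g c] gc on23_ident[of Z] assoc[OF H(8) H(7) that] ident_left[OF that] by simp
  define D where "D = on12 C Z g \<cdot> on23 C Z g \<cdot> on12 C Z g"
  have D: "D \<in> Hom C ?K ?K" unfolding D_def by (intro mult H)
  have cancel: "D \<cdot> (\<Delta> \<cdot> x) = x" if "x \<in> Hom C ?K ?K" for x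
    unfolding D_def \<Delta>_def by (simp add: assoc mult H that cancel1 cancel2)
  note swap = half_twist_conjugation[OF a, folded \<Delta>_def] half_twist_conjugation[OF b, folded \<Delta>_def]
  have "\<Delta> \<cdot> (on12 C Z a \<cdot> on23 C Z b \<cdot> on12 C Z a) =
      (\<Delta> \<cdot> on12 C Z a) \<cdot> (on23 C Z b \<cdot> on12 C Z a)"
    by (rule assoc[OF \<Delta> H(1) mult[OF H(6) H(1)], symmetric])
  also have "\<dots> = on23 C Z a \<cdot> ((\<Delta> \<cdot> on23 C Z b) \<cdot> on12 C Z a)"
    unfolding swap(1) by (simp add: assoc mult H \<Delta>)
  also have "\<dots> = on23 C Z a \<cdot> (on12 C Z b \<cdot> (\<Delta> \<cdot> on12 C Z a))"
    unfolding swap(4) by (simp add: assoc mult H \<Delta>)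
  also have "\<dots> = (on23 C Z a \<cdot> on12 C Z b \<cdot> on23 C Z a) \<cdot> \<Delta>"
    unfolding swap(1) by (simp add: assoc mult H \<Delta>)
  also have "\<dots> = t \<odot> (\<Delta> \<cdot> on12 C Z a)"
    unfolding t swap(1) by (rule compose_scl_left[OF H(5) \<Delta>])
  also have "\<dots> = \<Delta> \<cdot> (t \<odot> on12 C Z a)"
    by (rule compose_scl_right[OF \<Delta> H(1), symmetric])
  finally have "\<Delta> \<cdot> (on12 C Z a \<cdot> on23 C Z b \<cdot> on12 C Z a) = \<Delta> \<cdot> (t \<odot> on12 C Z a)" .
  moreover have "on12 C Z a \<cdot> on23 C Z b \<cdot> on12 C Z a \<in> Hom C ?K ?K" by (intro mult H)
  moreover have "t \<odot> on12 C Z a \<in> Hom C ?K ?K" by (intro Hom_scl H)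
  ultimately show ?thesis using cancel by metis
qed

end

section \<open>Projections onto simple summands\<close>

context semisimple_ribbon_category
begin

lemma End_scalar_if_iso_simple:
  assumes u: "is_iso C X Y u" and Y: "simple_object C Y" and f: "f \<in> Hom C X X"
  shows "\<exists>t. f = t \<odot> ident C X"
proof -
  let ?w = "inverse_mor C X Y u"
  have uH: "u \<in> Hom C X Y" using u unfolding is_iso_def by blast
  note w = inverse_mor[OF u]
  note fw = compose_in_Hom[OF f w(1)]
  obtain t where t: "u \<cdot> f \<cdot> ?w = t \<odot> ident C Y"
    using simple_End_scalar[OF Y compose_in_Hom[OF uH fw]] by blast
  have "f = ?w \<cdot> (u \<cdot> f \<cdot> ?w) \<cdot> u"
    unfolding compose_assoc[OF uH fw uH] compose_assoc[OF f w(1) uH] w(2) ident_right[OF f]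
      compose_assoc[OF w(1) uH f, symmetric] ident_left[OF f] ..
  also have "\<dots> = t \<odot> ident C X"
    unfolding t compose_scl_left[OF ident_in_Hom uH] ident_left[OF uH] compose_scl_right[OF w(1) uH] w(2) ..
  finally show ?thesis by blast
qed

text \<open>
  \<open>1 \<otimes> p\<close> factors as \<open>I \<cdot> R\<close> through \<open>Z \<otimes> \<one> \<cong> Z\<close>, and \<open>R \<cdot> (a \<otimes> 1) \<cdot> I\<close> is an endomorphism of that
  object, hence a scalar.
\<close>

lemma sandwich_scalar:
  assumes Z: "simple_object C Z" and p: "projection_onto C (Z \<otimes> Z) \<one> p"
    and a: "a \<in> Hom C (Z \<otimes> Z) (Z \<otimes> Z)"
  shows "\<exists>t. on23 C Z p \<cdot> on12 C Z a \<cdot> on23 C Z p = t \<odot> on23 C Z p"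
proof -
  obtain i r where i: "i \<in> Hom C \<one> (Z \<otimes> Z)" and r: "r \<in> Hom C (Z \<otimes> Z) \<one>" and pir: "p = i \<cdot> r"
    using p unfolding projection_onto_def by blast
  let ?K = "cube C Z"
  define I where "I = assoc_inv C Z Z Z \<cdot> (ident C Z \<boxtimes> i)"
  define R where "R = (ident C Z \<boxtimes> r) \<cdot> assoc C Z Z Z"
  note i' = ident_tens_in_Hom[OF i, of Z] and r' = ident_tens_in_Hom[OF r, of Z]
  have I: "I \<in> Hom C (Z \<otimes> \<one>) ?K"
    unfolding I_def cube_def by (rule compose_in_Hom[OF assoc_inv_in_Hom i'])
  have R: "R \<in> Hom C ?K (Z \<otimes> \<one>)"
    unfolding R_def cube_def by (rule compose_in_Hom[OF r' assoc_in_Hom])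
  have "on23 C Z p = assoc_inv C Z Z Z \<cdot> ((ident C Z \<boxtimes> i) \<cdot> (ident C Z \<boxtimes> r)) \<cdot> assoc C Z Z Z"
    using interchange[OF ident_in_Hom ident_in_Hom r i, of Z] ident_left[OF ident_in_Hom, of Z]
    by (simp add: on23_def pir)
  also have "\<dots> = I \<cdot> R"
    unfolding I_def R_def compose_assoc[OF i' r' assoc_in_Hom]
    by (rule compose_assoc[OF assoc_inv_in_Hom i' compose_in_Hom[OF r' assoc_in_Hom], symmetric])
  finally have pIR: "on23 C Z p = I \<cdot> R" .
  note a1 = on12_in_Hom[OF a]
  note aI = compose_in_Hom[OF a1 I]
  obtain t where t: "R \<cdot> on12 C Z a \<cdot> I = t \<odot> ident C (Z \<otimes> \<one>)"
    using End_scalar_if_iso_simple[OF runit_iso Z compose_in_Hom[OF R aI]] by blast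
  have "on23 C Z p \<cdot> on12 C Z a \<cdot> on23 C Z p = I \<cdot> (R \<cdot> on12 C Z a \<cdot> I) \<cdot> R"
    unfolding pIR compose_assoc[OF R aI R] compose_assoc[OF a1 I R]
    by (rule compose_assoc[OF I R compose_in_Hom[OF a1 compose_in_Hom[OF I R]]])
  also have "\<dots> = t \<odot> on23 C Z p"
    unfolding t compose_scl_left[OF ident_in_Hom R] ident_left[OF R] pIR
    by (rule compose_scl_right[OF I R])
  finally show ?thesis by blast
qed

text \<open>
  A summand isomorphic to \<open>Y k\<close> has no morphisms to or from the other \<open>Y j\<close>, so its inclusion \<open>i\<close>
  and retraction \<open>r\<close> pass through \<open>Y k\<close>, and \<open>i \<cdot> r\<close> amounts to a nonzero idempotent of \<open>End (Y k)\<close>.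
\<close>

lemma projection_onto_simple_summand:
  assumes X: "direct_sum C X I Y inc prj"
    and simple: "\<And>j. j \<in> I \<Longrightarrow> simple_object C (Y j)"
    and noniso: "\<And>j l. j \<in> I \<Longrightarrow> l \<in> I \<Longrightarrow> j \<noteq> l \<Longrightarrow> \<not> isomorphic C (Y j) (Y l)"
    and k: "k \<in> I" and W: "isomorphic C (Y k) W" and p: "projection_onto C X W p"
  shows "p = inc k \<cdot> prj k"
proof -
  have fin: "finite I" and inc: "\<And>j. j \<in> I \<Longrightarrow> inc j \<in> Hom C (Y j) X"
    and prj: "\<And>j. j \<in> I \<Longrightarrow> prj j \<in> Hom C X (Y j)"
    and one: "(\<Sum>j\<in>I. inc j \<cdot> prj j) = ident C X"
    using X unfolding direct_sum_def by auto
  obtain i r where i: "i \<in> Hom C W X" and r: "r \<in> Hom C X W"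
    and ri: "r \<cdot> i = ident C W" and pir: "p = i \<cdot> r"
    using p unfolding projection_onto_def by blast
  obtain u where u: "is_iso C (Y k) W u" using W unfolding isomorphic_def by blast
  then have uH: "u \<in> Hom C (Y k) W" unfolding is_iso_def by blast
  define w where "w = inverse_mor C (Y k) W u"
  note w = inverse_mor[OF u, folded w_def]
  have schur: "f = 0" if "f \<in> Hom C (Y j) (Y l)" "j \<in> I" "l \<in> I" "j \<noteq> l" for f j l
    using that simple_nonzero_is_iso[OF simple simple that(1)] noniso unfolding isomorphic_def by blast
  have ij: "inc j \<cdot> prj j \<in> Hom C X X" if "j \<in> I" for j
    using compose_in_Hom[OF inc prj] that by blast
  have prj_i: "prj j \<cdot> i = 0" if j: "j \<in> I" "j \<noteq> k" for j
  proof -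
    note pi = compose_in_Hom[OF prj[OF j(1)] i]
    have "(prj j \<cdot> i) \<cdot> u = 0" using schur[OF compose_in_Hom[OF pi uH] k j(1)] j(2) by simp
    then show ?thesis
      using compose_assoc[OF pi uH w(1)] w(3) ident_right[OF pi] compose_zero_left[OF w(1)] by simp
  qed
  have r_inc: "r \<cdot> inc j = 0" if j: "j \<in> I" "j \<noteq> k" for j
  proof -
    note ri' = compose_in_Hom[OF r inc[OF j(1)]]
    have "w \<cdot> (r \<cdot> inc j) = 0" using schur[OF compose_in_Hom[OF w(1) ri'] j(1) k j(2)] .
    then show ?thesis
      using compose_assoc[OF uH w(1) ri'] w(3) ident_left[OF ri'] compose_zero_right[OF uH] by simp
  qed
  let ?a = "prj k \<cdot> i" and ?b = "r \<cdot> inc k"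
  note a = compose_in_Hom[OF prj[OF k] i] and b = compose_in_Hom[OF r inc[OF k]]
  have "i = (\<Sum>j\<in>I. inc j \<cdot> prj j \<cdot> i)"
    using compose_sum_left[of I "\<lambda>j. inc j \<cdot> prj j", OF ij i] one ident_left[OF i]
    by (simp add: compose_assoc[OF inc prj i])
  also have "\<dots> = (\<Sum>j\<in>{k}. inc j \<cdot> prj j \<cdot> i)"
    using fin k compose_zero_right[OF inc] prj_i by (intro sum.mono_neutral_right) auto
  finally have i_eq: "i = inc k \<cdot> ?a" by simp
  have "r = (\<Sum>j\<in>I. r \<cdot> inc j \<cdot> prj j)"
    using compose_sum_right[where I = I and f = "\<lambda>j. inc j \<cdot> prj j", OF r ij] one ident_right[OF r] by simp
  also have "\<dots> = (\<Sum>j\<in>I. (r \<cdot> inc j) \<cdot> prj j)"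
    by (intro sum.cong refl) (simp add: compose_assoc[OF r inc prj])
  also have "\<dots> = (\<Sum>j\<in>{k}. (r \<cdot> inc j) \<cdot> prj j)"
    using fin k compose_zero_left[OF prj] r_inc by (intro sum.mono_neutral_right) auto
  finally have r_eq: "r = ?b \<cdot> prj k" by simp
  have ba: "?b \<cdot> ?a = ident C W"
    using compose_assoc[OF r inc[OF k] a] i_eq ri by simp
  note ab = compose_in_Hom[OF a b]
  have "(?a \<cdot> ?b) \<cdot> (?a \<cdot> ?b) = ?a \<cdot> ((?b \<cdot> ?a) \<cdot> ?b)"
    unfolding compose_assoc[OF a b ab] compose_assoc[OF b a b] ..
  then have idem: "(?a \<cdot> ?b) \<cdot> (?a \<cdot> ?b) = ?a \<cdot> ?b"
    unfolding ba ident_left[OF b] .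
  have "?a \<cdot> ?b \<noteq> 0"
  proof
    assume 0: "?a \<cdot> ?b = 0"
    have "?b = ?b \<cdot> (?a \<cdot> ?b)"
      unfolding compose_assoc[OF b a b, symmetric] ba ident_left[OF b] ..
    then have "?b = 0" unfolding 0 compose_zero_right[OF b] .
    then have "ident C W = 0" using ba compose_zero_left[OF a] by simp
    then have "u = 0" using ident_left[OF uH] compose_zero_left[OF uH] by simp
    then have "ident C (Y k) = 0" using w(2) compose_zero_right[OF w(1)] by simp
    then show False using simple[OF k] unfolding simple_object_def by blast
  qed
  then have ab1: "?a \<cdot> ?b = ident C (Y k)" using simple_idempotent[OF simple[OF k] ab idem] by blast
  have "p = (inc k \<cdot> ?a) \<cdot> (?b \<cdot> prj k)" unfolding pir using i_eq r_eq by simp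
  also have "\<dots> = inc k \<cdot> (?a \<cdot> ?b) \<cdot> prj k"
    unfolding compose_assoc[OF a b prj[OF k]]
    by (rule compose_assoc[OF inc[OF k] a compose_in_Hom[OF b prj[OF k]]])
  finally show ?thesis unfolding ab1 ident_left[OF prj[OF k]] .
qed

end

section \<open>The dimension formula\<close>

theorem corollary3p2:
  fixes C :: "('k::alg_closed_field, 'o, 'm::ab_group_add) ribbon_cat" (structure)
    and Z :: 'o and p :: 'm and dimZ :: 'k
    and d :: nat and Y :: "nat \<Rightarrow> 'o" and inc prj :: "nat \<Rightarrow> 'm" and lam :: "nat \<Rightarrow> 'k"
  assumes "semisimple_ribbon_category C"
    and "simple_object C Z"
    and "selfdual_object C Z"
    and "projection_onto C (Z \<otimes> Z) \<one> p"
    and "on23 C Z p \<cdot> on12 C Z p \<cdot> on23 C Z p \<noteq> 0"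
    and "summand_dim C Z p dimZ p = 1"
    and "2 \<le> d" and "d \<le> 5"
    and "direct_sum C (Z \<otimes> Z) {1..d} Y inc prj"
    and "\<And>i. i \<in> {1..d} \<Longrightarrow> simple_object C (Y i)"
    and "\<And>i j. i \<in> {1..d} \<Longrightarrow> j \<in> {1..d} \<Longrightarrow> i \<noteq> j \<Longrightarrow> \<not> isomorphic C (Y i) (Y j)"
    and "\<And>i. i \<in> {1..d} \<Longrightarrow> summand_dim C Z p dimZ (inc i \<cdot> prj i) \<noteq> 0"
    and "isomorphic C (Y 1) \<one>"
    and "\<And>i. i \<in> {1..d} \<Longrightarrow> braiding C Z Z \<cdot> inc i = lam i \<odot> inc i"
    and "inj_on lam {1..d}"
    and "i \<in> {1..d}"
  shows "summand_dim C Z p dimZ (inc i \<cdot> prj i) =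
           Q_scalar (scl C) (Hom C Z (cube C Z)) (sigma1 C Z) (sigma2 C Z) d lam 1 i * dimZ\<^sup>2 /
           (poly (P_poly d lam 1) (lam 1) * poly (P_poly d lam i) (lam i))"
proof -
  interpret semisimple_ribbon_category C by fact
  let ?c = "braiding C Z Z" and ?X = "Z \<otimes> Z" and ?K = "cube C Z"
  define q where "q = (\<lambda>j. inc j \<cdot> prj j)"
  have inc: "\<And>j. j \<in> {1..d} \<Longrightarrow> inc j \<in> Hom C (Y j) ?X"
    and prj: "\<And>j. j \<in> {1..d} \<Longrightarrow> prj j \<in> Hom C ?X (Y j)"
    and orth: "\<And>j l. j \<in> {1..d} \<Longrightarrow> l \<in> {1..d} \<Longrightarrow> prj j \<cdot> inc l = (if j = l then ident C (Y j) else 0)"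
    and one: "(\<Sum>j\<in>{1..d}. q j) = ident C ?X"
    using assms(9) unfolding direct_sum_def q_def by auto
  have d1: "1 \<in> {1..d}" using \<open>2 \<le> d\<close> by auto
  have q: "q j \<in> Hom C ?X ?X" if "j \<in> {1..d}" for j
    unfolding q_def using compose_in_Hom[OF inc prj] that by blast
  note c = braiding_in_Hom[of Z Z]
  have cq: "?c \<cdot> q j = lam j \<odot> q j" if j: "j \<in> {1..d}" for j
    unfolding q_def compose_assoc[OF c inc[OF j] prj[OF j], symmetric] assms(14)[OF j]
    by (rule compose_scl_left[OF inc[OF j] prj[OF j]])
  have prj_q: "prj j \<cdot> q l = (if j = l then prj j else 0)" if j: "j \<in> {1..d}" and l: "l \<in> {1..d}" for j l
    unfolding q_def compose_assoc[OF prj[OF j] inc[OF l] prj[OF l], symmetric] orth[OF j l]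
    using ident_left[OF prj[OF l]] compose_zero_left[OF prj[OF l]] by simp
  \<comment> \<open>The hypothesis describes \<open>c\<close> on the inclusions; the projections inherit it because they are
    dual to them.\<close>
  have c_eq: "?c = (\<Sum>l\<in>{1..d}. lam l \<odot> q l)"
    using compose_sum_right[OF c, of "{1..d}" q, OF q] one ident_right[OF c] cq by simp
  have prj_c: "prj j \<cdot> ?c = lam j \<odot> prj j" if j: "j \<in> {1..d}" for j
  proof -
    have "prj j \<cdot> ?c = (\<Sum>l\<in>{1..d}. prj j \<cdot> (lam l \<odot> q l))"
      unfolding c_eq by (rule compose_sum_right[OF prj[OF j] Hom_scl[OF q]])
    also have "\<dots> = (\<Sum>l\<in>{1..d}. if j = l then lam j \<odot> prj j else 0)"
      by (intro sum.cong refl) (simp add: compose_scl_right[OF prj[OF j] q] prj_q[OF j])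
    finally show ?thesis using j by simp
  qed
  have comm: "?c \<cdot> q j = q j \<cdot> ?c" if j: "j \<in> {1..d}" for j
    unfolding cq[OF j]
    unfolding q_def compose_assoc[OF inc[OF j] prj[OF j] c] prj_c[OF j]
    by (rule compose_scl_right[OF inc[OF j] prj[OF j], symmetric])
  have p: "p = q 1"
    unfolding q_def using projection_onto_simple_summand[OF assms(9,10,11) d1 assms(13,4)] .
  obtain t where t: "on23 C Z p \<cdot> on12 C Z (q i) \<cdot> on23 C Z p = t \<odot> on23 C Z p"
    using sandwich_scalar[OF assms(2,4) q[OF assms(16)]] by blast
  have t': "on12 C Z p \<cdot> on23 C Z (q i) \<cdot> on12 C Z p = t \<odot> on12 C Z p"
    using sandwich_exchange[OF q[OF d1] comm[OF d1] q[OF assms(16)] comm[OF assms(16)]] t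
    unfolding p by blast
  have pH: "p \<in> Hom C ?X ?X" unfolding p by (rule q[OF d1])
  have "on23 C Z p \<noteq> 0"
    using assms(5) compose_zero_left[OF compose_in_Hom[OF on12_in_Hom[OF pH] on23_in_Hom[OF pH]]] by metis
  then have dim: "summand_dim C Z p dimZ (q i) = dimZ\<^sup>2 * t"
    unfolding summand_dim_def t by (intro the_equality) simp_all
  define b1 where "b1 = poly (P_poly d lam 1) (lam 1)"
  define bi where "bi = poly (P_poly d lam i) (lam i)"
  have b: "poly (P_poly d lam j) (lam j) \<noteq> 0" if "j \<in> {1..d}" for j
  proof -
    have "lam j - lam l \<noteq> 0" if "l \<in> {1..d} - {j}" for l
      using inj_onD[OF assms(15), of j l] \<open>j \<in> {1..d}\<close> that by auto
    then show ?thesis unfolding P_poly_def poly_prod by (simp add: prod_zero_iff)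
  qed
  have A: "poly_endo (scl C) (P_poly d lam 1) (sigma1 C Z) v = b1 \<odot> (on12 C Z p \<cdot> v)"
    if v: "v \<in> Hom C Z ?K" for v
    unfolding sigma1_def[abs_def] p b1_def
  proof (rule P_poly_endo_of_eigendecomposition[where e = "\<lambda>j. on12 C Z (q j)"])
    show "on12 C Z ?c \<cdot> on12 C Z (q j) = lam j \<odot> on12 C Z (q j)" if j: "j \<in> {1..d}" for j
      using on12_compose[OF c q[OF j]] on12_scl[OF q[OF j]] cq[OF j] by simp
    show "(\<Sum>j\<in>{1..d}. on12 C Z (q j)) = ident C ?K"
      using on12_sum[of "{1..d}" q Z] q one on12_ident[of Z] by simp
  qed (fact on12_in_Hom[OF c] on12_in_Hom[OF q] v d1)+
  have B: "poly_endo (scl C) (P_poly d lam i) (sigma2 C Z) v = bi \<odot> (on23 C Z (q i) \<cdot> v)"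
    if v: "v \<in> Hom C Z ?K" for v
    unfolding sigma2_def[abs_def] bi_def
  proof (rule P_poly_endo_of_eigendecomposition[where e = "\<lambda>j. on23 C Z (q j)"])
    show "on23 C Z ?c \<cdot> on23 C Z (q j) = lam j \<odot> on23 C Z (q j)" if j: "j \<in> {1..d}" for j
      using on23_compose[OF c q[OF j]] on23_scl[OF q[OF j]] cq[OF j] by simp
    show "(\<Sum>j\<in>{1..d}. on23 C Z (q j)) = ident C ?K"
      using on23_sum[of "{1..d}" q Z] q one on23_ident[of Z] by simp
  qed (fact on23_in_Hom[OF c] on23_in_Hom[OF q] v assms(16))+
  note p1 = on12_in_Hom[OF pH] and q2 = on23_in_Hom[OF q[OF assms(16)]]
  have ABA: "poly_endo (scl C) (P_poly d lam 1) (sigma1 C Z)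
      (poly_endo (scl C) (P_poly d lam i) (sigma2 C Z)
        (poly_endo (scl C) (P_poly d lam 1) (sigma1 C Z) v)) =
      (t * b1 * bi) \<odot> poly_endo (scl C) (P_poly d lam 1) (sigma1 C Z) v"
    if v: "v \<in> Hom C Z ?K" for v
  proof -
    note pv = compose_in_Hom[OF p1 v]
    note qpv = compose_in_Hom[OF q2 pv]
    have "on12 C Z p \<cdot> on23 C Z (q i) \<cdot> on12 C Z p \<cdot> v =
        (on12 C Z p \<cdot> on23 C Z (q i) \<cdot> on12 C Z p) \<cdot> v"
      unfolding compose_assoc[OF p1 compose_in_Hom[OF q2 p1] v] compose_assoc[OF q2 p1 v] ..
    then have "on12 C Z p \<cdot> on23 C Z (q i) \<cdot> on12 C Z p \<cdot> v = t \<odot> (on12 C Z p \<cdot> v)"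
      unfolding t' compose_scl_left[OF p1 v] .
    then show ?thesis
      unfolding A[OF v] B[OF Hom_scl[OF pv]] compose_scl_right[OF q2 pv]
        A[OF Hom_scl[OF Hom_scl[OF qpv]]] compose_scl_right[OF p1 Hom_scl[OF qpv]]
        compose_scl_right[OF p1 qpv]
      by (simp add: algebra_simps)
  qed
  obtain v0 where v0: "v0 \<in> Hom C Z ?K" "on12 C Z p \<cdot> v0 \<noteq> 0"
    using on12_summand_nonzero[OF _ assms(4)] assms(2) unfolding simple_object_def by blast
  have "Q_scalar (scl C) (Hom C Z ?K) (sigma1 C Z) (sigma2 C Z) d lam 1 i = t * b1 * bi"
    unfolding Q_scalar_def
  proof (rule the_equality)
    fix s
    assume "\<forall>v\<in>Hom C Z ?K. poly_endo (scl C) (P_poly d lam 1) (sigma1 C Z)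
        (poly_endo (scl C) (P_poly d lam i) (sigma2 C Z)
          (poly_endo (scl C) (P_poly d lam 1) (sigma1 C Z) v)) =
        s \<odot> poly_endo (scl C) (P_poly d lam 1) (sigma1 C Z) v"
    then have "s \<odot> b1 \<odot> (on12 C Z p \<cdot> v0) = (t * b1 * bi) \<odot> b1 \<odot> (on12 C Z p \<cdot> v0)"
      using ABA[OF v0(1)] v0(1) A by metis
    then show "s = t * b1 * bi"
      using v0(2) b[OF d1] by (simp add: b1_def)
  qed (use ABA in blast)
  then show ?thesis
    using dim b[OF d1] b[OF assms(16)] unfolding q_def b1_def[symmetric] bi_def[symmetric]
    by (simp add: field_simps)
qed

end
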